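(* Each of the following planar quadratic differential systems in the variables $(z,y)$ has the indicated algebraic curve $g=0$, of degree fifteen and genus two, as an invariant algebraic curve with cofactor $K=15y$. (i) For a real parameter $q\neq0$, the system $$\dot z=zy+1,\qquad \dot y=3y^2-\tfrac{6}{17}qzy-\tfrac{8}{289}q^2z^2+q,$$ with $$\begin{aligned} g={}&y^5-\tfrac{135}{1156}q^3z+\tfrac{204600}{410338673}z^9q^7-\tfrac{49546}{1419857}z^5q^5-\tfrac{31800}{24137569}z^7q^6-\tfrac{365760}{6975757441}q^8z^{11}\\ &-\tfrac{36864}{2015993900449}z^{15}q^{10}+\tfrac{11915}{250563}z^3q^4-\tfrac{300}{289}z^3y^4q^2-\tfrac{15}{17}zy^4q-\tfrac{69120}{6975757441}yz^{12}q^8\\ &+\tfrac{14250}{83521}yz^4q^4-\tfrac{99000}{24137569}yz^8q^6-\tfrac{685}{4913}yq^3z^2+\tfrac{19800}{1419857}yz^6q^5+\tfrac{190080}{410338673}yq^7z^{10}\\ &-\tfrac{15780}{83521}y^2z^5q^4+\tfrac{11880}{1419857}y^2q^5z^7-\tfrac{190}{289}y^2q^2z-\tfrac{485}{4913}y^2q^3z^3-\tfrac{31680}{24137569}y^2z^9q^6\\ &-\tfrac{145}{289}y^3q^2z^2+\tfrac{3600}{4913}y^3z^4q^3-\tfrac{1320}{83521}y^3z^6q^4+\tfrac{207360}{118587876497}q^9z^{13}+\tfrac{135}{1156}yq^2+\tfrac{35}{51}y^3q. \end{aligned}$$ (ii) For a real parameter $p\neq 0$, the system $$\dot z=zy+1,\qquad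 \dot y=3y^2-\tfrac43pzy-\tfrac{16}3p^2z^2+p,$$ with $$\begin{aligned} g={}&y^5+\tfrac{2621440}{19683}yz^{12}p^8+\tfrac{2560000}{19683}yp^6z^8-\tfrac{313600}{6561}yp^5z^6-\tfrac{3768320}{19683}yp^7z^{10}+\tfrac{1300}{81}y^4z^3p^2-\tfrac{10}{3}y^4zp\\ &+\tfrac{265}{27}y^3p^2z^2-\tfrac{10400}{243}y^3z^4p^3+\tfrac{474880}{6561}y^3z^6p^4+\tfrac{143840}{2187}y^2p^4z^5-\tfrac{949760}{6561}y^2p^5z^7+\tfrac{35}{54}y^2p^2z\\ &-\tfrac{9130}{729}y^2z^3p^3+\tfrac{942080}{6561}y^2z^9p^6-\tfrac{695}{486}yp^3z^2+\tfrac{7000}{729}yp^4z^4+\tfrac{5}{18}y^3p+\tfrac{8388608}{177147}z^{15}p^{10}-\tfrac{10}{81}p^3z\\ &+\tfrac{1015}{1458}p^4z^3-\tfrac{2512}{729}p^5z^5+\tfrac{10}{81}yp^2+\tfrac{92800}{6561}p^6z^7-\tfrac{7577600}{177147}p^7z^9+\tfrac{4751360}{59049}z^{11}p^8-\tfrac{5242880}{59049}p^9z^{13}. \end{aligned}$$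
   Context: For a polynomial differential system $\dot z=P(z,y)$, $\dot y=Q(z,y)$, an algebraic curve $g(z,y)=0$ (with $g$ a polynomial) is invariant with cofactor $K$, where $K$ is a polynomial, if $P\,\partial g/\partial z+Q\,\partial g/\partial y=K g$ identically. The degree of the curve is the total degree of $g$ in $(z,y)$; the genus of the curve is the geometric genus of the complex projective curve defined by $g$. The system is quadratic if $\max(\deg P,\deg Q)=2$. *)

theory Defs
  imports
    "HOL-Computational_Algebra.Computational_Algebra"
begin

text \<open>
  A polynomial in \<open>(z, y)\<close> has type \<open>'a poly poly\<close>: the inner variable is \<open>z\<close>, the outer one
  is \<open>y\<close>, so the coefficient of \<open>z^i y^j\<close> in \<open>p\<close> is \<open>coeff (coeff p j) i\<close>.
\<close>

definition Const :: "'a::comm_ring_1 \<Rightarrow> 'a poly poly" where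
  "Const c = [:[:c:]:]"

definition Z :: "'a::comm_ring_1 poly poly" where
  "Z = [:[:0, 1:]:]"

definition Y :: "'a::comm_ring_1 poly poly" where
  "Y = [:0, 1:]"

definition deriv_z :: "real poly poly \<Rightarrow> real poly poly" where
  "deriv_z p = map_poly pderiv p"

definition deriv_y :: "real poly poly \<Rightarrow> real poly poly" where
  "deriv_y p = pderiv p"

definition total_degree :: "'a::comm_ring_1 poly poly \<Rightarrow> nat" where
  "total_degree p = Max (insert 0 {i + j | i j. coeff (coeff p j) i \<noteq> 0})"

definition quadratic_system :: "real poly poly \<Rightarrow> real poly poly \<Rightarrow> bool" where
  "quadratic_system P Q \<longleftrightarrow> max (total_degree P) (total_degree Q) = 2"

definition invariant_curve ::
    "real poly poly \<Rightarrow> real poly poly \<Rightarrow> real poly poly \<Rightarrow> real poly poly \<Rightarrow> bool" where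
  "invariant_curve P Q g K \<longleftrightarrow> P * deriv_z g + Q * deriv_y g = K * g"

definition complexify :: "real poly poly \<Rightarrow> complex poly poly" where
  "complexify p = map_poly (map_poly complex_of_real) p"


text \<open>
  The geometric genus of an irreducible complex plane curve is the dimension of the space of
  regular differentials on the smooth projective model of its function field \<open>K\<close>. The points of
  that model are the valuation rings of \<open>K\<close> over the complex numbers, which include those lying
  over the line at infinity.

  All function fields are realised inside the field of formal Laurent series, in which every
  one-variable complex function field embeds (by completion at a place).
\<close>

definition eval2 :: "complex poly poly \<Rightarrow> complex fls \<Rightarrow> complex fls \<Rightarrow> complex fls" where
  "eval2 p a b = poly (map_poly (\<lambda>c. poly (map_poly fls_const c) a) p) b"

text \<open>
  For irreducible \<open>g\<close>, the kernel of evaluation at a generic point is a non-maximal prime ideal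
  containing \<open>g\<close>, hence equals the ideal generated by \<open>g\<close>. The field generated by a generic point
  is therefore isomorphic over the complex numbers to the field of fractions of the coordinate
  ring, whichever generic point is taken.
\<close>

definition generic_point :: "complex poly poly \<Rightarrow> complex fls \<Rightarrow> complex fls \<Rightarrow> bool" where
  "generic_point g a b \<longleftrightarrow>
     eval2 g a b = 0 \<and> \<not> (a \<in> range fls_const \<and> b \<in> range fls_const)"

definition generated_field :: "complex fls \<Rightarrow> complex fls \<Rightarrow> complex fls set" where
  "generated_field a b = {eval2 p a b / eval2 r a b | p r. eval2 r a b \<noteq> 0}"

definition function_field_of :: "complex poly poly \<Rightarrow> complex fls set \<Rightarrow> bool" where
  "function_field_of g K \<longleftrightarrow> (\<exists>a b. generic_point g a b \<and> K = generated_field a b)"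

definition valuation_rings :: "complex fls set \<Rightarrow> complex fls set set" where
  "valuation_rings K =
     {R. range fls_const \<subset> R \<and> R \<subset> K \<and>
         (\<forall>f\<in>R. \<forall>h\<in>R. f - h \<in> R \<and> f * h \<in> R) \<and>
         (\<forall>f\<in>K. f \<in> R \<or> inverse f \<in> R)}"

text \<open>
  A differential \<open>\<Sum>i. f i * d (h i)\<close> is represented by the series \<open>\<Sum>i. f i * (h i)'\<close>. On the
  Kaehler differentials of a one-variable function field this is injective, since they form a
  one-dimensional space over the field and the formal derivative of a nonconstant series is
  nonzero. For a valuation ring \<open>R\<close>, \<open>differentials R\<close> is the image of the Kaehler differentials
  of \<open>R\<close>, that is, the differentials regular at the corresponding point.
\<close>

definition differentials :: "complex fls set \<Rightarrow> complex fls set" where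
  "differentials R =
     {\<Sum>i<n. f i * fls_deriv (h i) | n f h. \<forall>i<n::nat. f i \<in> R \<and> h i \<in> R}"

definition regular_differentials :: "complex fls set \<Rightarrow> complex fls set" where
  "regular_differentials K =
     {\<omega> \<in> differentials K. \<forall>R\<in>valuation_rings K. \<omega> \<in> differentials R}"

global_interpretation fls_vs: vector_space "\<lambda>c f. fls_const (c::complex) * f"
  by standard (simp_all add: algebra_simps flip: fls_plus_const fls_const_mult_const)

definition has_geometric_genus :: "complex poly poly \<Rightarrow> nat \<Rightarrow> bool" where
  "has_geometric_genus g n \<longleftrightarrow>
     irreducible g \<and>
     (\<exists>K. function_field_of g K \<and> fls_vs.dim (regular_differentials K) = n)"


definition g1 :: "real \<Rightarrow> real poly poly" where
  "g1 q =
     Y^5 - Const (135/1156 * q^3) * Z + Const (204600/410338673 * q^7) * Z^9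
     - Const (49546/1419857 * q^5) * Z^5 - Const (31800/24137569 * q^6) * Z^7 - Const (365760/6975757441 * q^8) * Z^11
     - Const (36864/2015993900449 * q^10) * Z^15 + Const (11915/250563 * q^4) * Z^3 - Const (300/289 * q^2) * Z^3 * Y^4
     - Const (15/17 * q) * Z * Y^4 - Const (69120/6975757441 * q^8) * Z^12 * Y + Const (14250/83521 * q^4) * Z^4 * Y
     - Const (99000/24137569 * q^6) * Z^8 * Y - Const (685/4913 * q^3) * Z^2 * Y + Const (19800/1419857 * q^5) * Z^6 * Y
     + Const (190080/410338673 * q^7) * Z^10 * Y - Const (15780/83521 * q^4) * Z^5 * Y^2 + Const (11880/1419857 * q^5) * Z^7 * Y^2
     - Const (190/289 * q^2) * Z * Y^2 - Const (485/4913 * q^3) * Z^3 * Y^2 - Const (31680/24137569 * q^6) * Z^9 * Y^2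
     - Const (145/289 * q^2) * Z^2 * Y^3 + Const (3600/4913 * q^3) * Z^4 * Y^3 - Const (1320/83521 * q^4) * Z^6 * Y^3
     + Const (207360/118587876497 * q^9) * Z^13 + Const (135/1156 * q^2) * Y + Const (35/51 * q) * Y^3"

definition g2 :: "real \<Rightarrow> real poly poly" where
  "g2 p =
     Y^5 + Const (2621440/19683 * p^8) * Z^12 * Y + Const (2560000/19683 * p^6) * Z^8 * Y
     - Const (313600/6561 * p^5) * Z^6 * Y - Const (3768320/19683 * p^7) * Z^10 * Y + Const (1300/81 * p^2) * Z^3 * Y^4
     - Const (10/3 * p) * Z * Y^4 + Const (265/27 * p^2) * Z^2 * Y^3 - Const (10400/243 * p^3) * Z^4 * Y^3
     + Const (474880/6561 * p^4) * Z^6 * Y^3 + Const (143840/2187 * p^4) * Z^5 * Y^2 - Const (949760/6561 * p^5) * Z^7 * Y^2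
     + Const (35/54 * p^2) * Z * Y^2 - Const (9130/729 * p^3) * Z^3 * Y^2 + Const (942080/6561 * p^6) * Z^9 * Y^2
     - Const (695/486 * p^3) * Z^2 * Y + Const (7000/729 * p^4) * Z^4 * Y + Const (5/18 * p) * Y^3
     + Const (8388608/177147 * p^10) * Z^15 - Const (10/81 * p^3) * Z + Const (1015/1458 * p^4) * Z^3
     - Const (2512/729 * p^5) * Z^5 + Const (10/81 * p^2) * Y + Const (92800/6561 * p^6) * Z^7
     - Const (7577600/177147 * p^7) * Z^9 + Const (4751360/59049 * p^8) * Z^11 - Const (5242880/59049 * p^9) * Z^13"

end

theory Submission
  imports Defs "HOL-Computational_Algebra.Field_as_Ring"
begin

text \<open>
  The curves are invariant under \<open>(z, y) \<mapsto> (-z, -y)\<close>, and this involution has six fixed points: the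
  origin and five points at infinity. Taking a coordinate \<open>t\<close> on the rational quotient with
  \<open>t = \<infinity>\<close> at the origin gives a parametrization \<open>z = \<mu> A(t) / w\<close>, \<open>y = \<nu> B(t) / w\<^sup>3\<close> over a
  hyperelliptic curve \<open>w\<^sup>2 = f(t)\<close> with \<open>f\<close> squarefree of degree five, and \<open>t\<close> is a rational function
  of \<open>z\<close> and \<open>y\<close>. That the parametrized point lies on \<open>g = 0\<close> follows from the invariance: the
  parametrization is an integral curve of the system through the origin, along which \<open>g\<close> satisfies
  a linear homogeneous differential equation and starts at zero. Irreducibility holds since the
  parametrization meets \<open>z = 0\<close> in five points with distinct \<open>y\<close>.

  The regular differentials on \<open>w\<^sup>2 = f(t)\<close>, \<open>deg f = 2 g + 1\<close>, are \<open>p(t) dt / w\<close> with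
  \<open>deg p < g\<close>. Regularity in an arbitrary valuation ring follows from a Bezout identity for \<open>f\<close> and
  \<open>f'\<close>. Conversely, the substitutions \<open>t = c + X\<^sup>2\<close> and \<open>t = X\<^sup>-\<^sup>2\<close> embed the function field into the
  Laurent series in \<open>X\<close>, and the valuation rings so obtained bound all poles.
\<close>

section \<open>Evaluation of polynomials at Laurent series\<close>

lemma map_poly_add_hom:
  assumes "\<phi> 0 = 0" "\<And>a b. \<phi> (a + b) = \<phi> a + \<phi> b"
  shows "map_poly \<phi> (p + q) = map_poly \<phi> p + map_poly \<phi> q"
  by (rule poly_eqI) (simp add: coeff_map_poly assms)

lemma map_poly_mult_hom:
  fixes \<phi> :: "'a::comm_semiring_1 \<Rightarrow> 'b::comm_semiring_1"
  assumes "\<phi> 0 = 0" "\<And>a b. \<phi> (a + b) = \<phi> a + \<phi> b" "\<And>a b. \<phi> (a * b) = \<phi> a * \<phi> b"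
  shows "map_poly \<phi> (p * q) = map_poly \<phi> p * map_poly \<phi> q"
proof (induction p)
  case (pCons a p)
  have "map_poly \<phi> (smult a q) = smult (\<phi> a) (map_poly \<phi> q)"
    by (rule poly_eqI) (simp add: coeff_map_poly assms)
  with pCons show ?case
    by (simp add: map_poly_pCons map_poly_add_hom assms)
qed simp

definition ev :: "complex poly \<Rightarrow> complex fls \<Rightarrow> complex fls" where
  "ev p x = poly (map_poly fls_const p) x"

lemma ev_simps [simp]:
  "ev 0 x = 0" "ev 1 x = 1" "ev (pCons c p) x = fls_const c + x * ev p x"
  "ev (p + q) x = ev p x + ev q x" "ev (p * q) x = ev p x * ev q x"
  "ev (smult c p) x = fls_const c * ev p x"
  by (simp_all add: ev_def map_poly_pCons map_poly_add_hom map_poly_mult_hom fls_plus_const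
      map_poly_smult)

lemma ev_minus [simp]: "ev (- p) x = - ev p x"
  using ev_simps(4)[of p "- p" x] by (simp add: eq_neg_iff_add_eq_0 add.commute)

lemma ev_diff [simp]: "ev (p - q) x = ev p x - ev q x"
  using ev_simps(4)[of p "- q" x] by simp

lemma ev_power [simp]: "ev (p ^ n) x = ev p x ^ n"
  by (induction n) simp_all

lemma ev_const: "ev [:c:] x = fls_const c"
  by simp

lemma ev_numeral [simp]: "ev (numeral k) x = numeral k"
  using ev_const[of "numeral k" x] by (simp add: numeral_poly)

lemma ev_monom: "ev (monom c n) x = fls_const c * x ^ n"
  by (induction n) (simp_all add: monom_0 monom_Suc algebra_simps)

lemma ev_sum [simp]: "ev (\<Sum>i\<in>I. F i) x = (\<Sum>i\<in>I. ev (F i) x)"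
  by (induction I rule: infinite_finite_induct) simp_all

lemma eval2_simps [simp]:
  "eval2 0 a b = 0" "eval2 1 a b = 1" "eval2 (pCons c p) a b = ev c a + b * eval2 p a b"
  "eval2 (p + q) a b = eval2 p a b + eval2 q a b" "eval2 (p * q) a b = eval2 p a b * eval2 q a b"
proof -
  have h: "eval2 p a b = poly (map_poly (\<lambda>c. ev c a) p) b" for p
    by (simp add: eval2_def ev_def)
  show "eval2 0 a b = 0" "eval2 1 a b = 1" "eval2 (pCons c p) a b = ev c a + b * eval2 p a b"
    "eval2 (p + q) a b = eval2 p a b + eval2 q a b" "eval2 (p * q) a b = eval2 p a b * eval2 q a b"
    by (simp_all add: h map_poly_pCons map_poly_add_hom map_poly_mult_hom)
qed

lemma eval2_diff [simp]: "eval2 (p - q) a b = eval2 p a b - eval2 q a b"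
  using eval2_simps(4)[of "p - q" q a b] by simp

lemma eval2_power [simp]: "eval2 (p ^ n) a b = eval2 p a b ^ n"
  by (induction n) simp_all

lemma eval2_Const [simp]: "eval2 (Const c) a b = fls_const c"
  and eval2_Z [simp]: "eval2 Z a b = a"
  and eval2_Y [simp]: "eval2 Y a b = b"
  by (simp_all add: Const_def Z_def Y_def)

lemma ev_deriv: "fls_deriv (ev p x) = ev (pderiv p) x * fls_deriv x"
  by (induction p) (simp_all add: pderiv_pCons algebra_simps)

text \<open>A nonconstant series is transcendental over the complex numbers: a root of
  \<open>p\<close> splits off a linear factor, which cannot vanish at \<open>t\<close>, and
  induction on the degree handles the cofactor.\<close>

lemma ev_eq_0_iff:
  assumes "t \<notin> range fls_const"
  shows "ev p t = 0 \<longleftrightarrow> p = 0"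
proof (induction "degree p" arbitrary: p)
  case 0
  then show ?case by (metis degree_0_id ev_const fls_const_eq_0_iff pCons_eq_0_iff)
next
  case (Suc n)
  then obtain z where "poly p z = 0"
    using fundamental_theorem_of_algebra constant_degree by (metis nat.distinct(1))
  then obtain q where p: "p = [:- z, 1:] * q"
    using poly_eq_0_iff_dvd by (metis dvdE)
  have q: "q \<noteq> 0"
    using Suc(2) p by auto
  then have "degree p = Suc (degree q)"
    unfolding p by (subst degree_mult_eq) simp_all
  with Suc(2) have "degree q = n" by simp
  moreover have "t - fls_const z \<noteq> 0"
    using assms by auto
  moreover have "ev p t = (t - fls_const z) * ev q t"
    by (simp add: p algebra_simps)
  moreover have "p \<noteq> 0"
    using Suc(2) by auto
  ultimately show ?case
    using Suc(1)[of q] q by simp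
qed

section \<open>Subfields of the Laurent series and generated fields\<close>

definition subfield :: "complex fls set \<Rightarrow> bool" where
  "subfield L \<longleftrightarrow> range fls_const \<subseteq> L \<and> (\<forall>x\<in>L. \<forall>y\<in>L. x - y \<in> L \<and> x * y \<in> L) \<and>
     (\<forall>x\<in>L. inverse x \<in> L)"

lemma subfieldD:
  assumes "subfield L"
  shows subfield_const: "fls_const c \<in> L" and subfield_0: "0 \<in> L" and subfield_1: "1 \<in> L"
    and subfield_diff: "x \<in> L \<Longrightarrow> y \<in> L \<Longrightarrow> x - y \<in> L"
    and subfield_uminus: "x \<in> L \<Longrightarrow> - x \<in> L"
    and subfield_add: "x \<in> L \<Longrightarrow> y \<in> L \<Longrightarrow> x + y \<in> L"
    and subfield_mult: "x \<in> L \<Longrightarrow> y \<in> L \<Longrightarrow> x * y \<in> L"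
    and subfield_inverse: "x \<in> L \<Longrightarrow> inverse x \<in> L"
    and subfield_divide: "x \<in> L \<Longrightarrow> y \<in> L \<Longrightarrow> x / y \<in> L"
    and subfield_power: "x \<in> L \<Longrightarrow> x ^ n \<in> L"
    and subfield_numeral: "numeral k \<in> L"
proof -
  show c: "fls_const c \<in> L" for c
    using assms by (auto simp: subfield_def)
  show 0: "0 \<in> L" and 1: "1 \<in> L" and "numeral k \<in> L"
    using c[of 0] c[of 1] c[of "numeral k"] by simp_all
  show d: "x - y \<in> L" if "x \<in> L" "y \<in> L" for x y
    using assms that by (simp add: subfield_def)
  show m: "- x \<in> L" if "x \<in> L" for x
    using d[OF 0 that] by simp
  show "x + y \<in> L" if "x \<in> L" "y \<in> L" for x y
    using d[OF that(1) m[OF that(2)]] by simp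
  show p: "x * y \<in> L" if "x \<in> L" "y \<in> L" for x y
    using assms that by (simp add: subfield_def)
  show i: "inverse x \<in> L" if "x \<in> L" for x
    using assms that by (simp add: subfield_def)
  show "x / y \<in> L" if "x \<in> L" "y \<in> L" for x y
    using p[OF that(1) i[OF that(2)]] by (simp add: divide_inverse)
  show "x ^ n \<in> L" if "x \<in> L" for x
    using that by (induction n) (auto intro: 1 p)
qed

lemmas subfield_intros = subfield_const subfield_0 subfield_1 subfield_diff subfield_uminus
  subfield_add subfield_mult subfield_inverse subfield_divide subfield_power subfield_numeral

lemma ev_in_subfield: "subfield L \<Longrightarrow> x \<in> L \<Longrightarrow> ev p x \<in> L"
  by (induction p) (auto intro: subfield_intros)

lemma eval2_in_subfield: "subfield L \<Longrightarrow> a \<in> L \<Longrightarrow> b \<in> L \<Longrightarrow> eval2 p a b \<in> L"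
  by (induction p) (auto intro: subfield_intros ev_in_subfield)

text \<open>Serves as an induction principle: a property holds on \<open>generated_field a b\<close>
  once the elements having it form a subfield that contains \<open>a\<close> and
  \<open>b\<close>.\<close>

lemma generated_field_least:
  assumes "subfield L" "a \<in> L" "b \<in> L"
  shows "generated_field a b \<subseteq> L"
  using assms by (auto simp: generated_field_def intro!: subfield_intros eval2_in_subfield)

lemma generated_fieldI: "eval2 r a b \<noteq> 0 \<Longrightarrow> eval2 p a b / eval2 r a b \<in> generated_field a b"
  by (auto simp: generated_field_def)

lemma eval2_in_generated_field: "eval2 p a b \<in> generated_field a b"
  using generated_fieldI[of 1 a b p] by simp

lemma subfield_generated_field: "subfield (generated_field a b)"
  unfolding subfield_def
proof (intro conjI ballI)
  show "range fls_const \<subseteq> generated_field a b"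
    using eval2_in_generated_field[of "Const _" a b] by auto
next
  fix x y assume "x \<in> generated_field a b" "y \<in> generated_field a b"
  then obtain p r p' r' where x: "x = eval2 p a b / eval2 r a b" "eval2 r a b \<noteq> 0"
    and y: "y = eval2 p' a b / eval2 r' a b" "eval2 r' a b \<noteq> 0"
    by (auto simp: generated_field_def)
  have "x - y = eval2 (p * r' - p' * r) a b / eval2 (r * r') a b"
    using x y by (simp add: diff_frac_eq)
  then show "x - y \<in> generated_field a b"
    using x(2) y(2) generated_fieldI[of "r * r'" a b "p * r' - p' * r"] by simp
  have "x * y = eval2 (p * p') a b / eval2 (r * r') a b"
    using x y by simp
  then show "x * y \<in> generated_field a b"
    using x(2) y(2) generated_fieldI[of "r * r'" a b "p * p'"] by simp
next
  fix x assume "x \<in> generated_field a b"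
  then obtain p r where x: "x = eval2 p a b / eval2 r a b" "eval2 r a b \<noteq> 0"
    by (auto simp: generated_field_def)
  show "inverse x \<in> generated_field a b"
  proof (cases "eval2 p a b = 0")
    case True
    then show ?thesis using x eval2_in_generated_field[of 0 a b] by simp
  next
    case False
    then show ?thesis using x by (auto intro: generated_fieldI)
  qed
qed

lemma generators_in_generated_field:
  "a \<in> generated_field a b" "b \<in> generated_field a b"
  using eval2_in_generated_field[of Z a b] eval2_in_generated_field[of Y a b] by simp_all

lemma generated_field_eqI:
  assumes "a \<in> generated_field t w" "b \<in> generated_field t w"
    "t \<in> generated_field a b" "w \<in> generated_field a b"
  shows "generated_field a b = generated_field t w"
  using assms by (intro equalityI generated_field_least subfield_generated_field)

section \<open>Places of a hyperelliptic function field\<close>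

lemma fls_nonneg_iff: "fls_subdegree x \<ge> 0 \<longleftrightarrow> x \<in> range fps_to_fls"
  using fls_subdegree_fls_to_fps_gt0 fls_regpart_to_fls_trivial by (metis imageE rangeI)

lemma fls_nonneg_add:
  "fls_subdegree x \<ge> 0 \<Longrightarrow> fls_subdegree y \<ge> 0 \<Longrightarrow> fls_subdegree (x + y) \<ge> 0"
  unfolding fls_nonneg_iff by (auto simp flip: fps_to_fls_plus)

lemma fls_nonneg_diff:
  "fls_subdegree x \<ge> 0 \<Longrightarrow> fls_subdegree y \<ge> 0 \<Longrightarrow> fls_subdegree (x - y) \<ge> 0"
  unfolding fls_nonneg_iff by (auto simp flip: fps_to_fls_minus)

lemma fls_nonneg_mult:
  fixes x y :: "'a::comm_ring_1 fls"
  shows "fls_subdegree x \<ge> 0 \<Longrightarrow> fls_subdegree y \<ge> 0 \<Longrightarrow> fls_subdegree (x * y) \<ge> 0"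
  unfolding fls_nonneg_iff by (auto simp flip: fls_times_fps_to_fls)

lemma fls_nonneg_deriv: "fls_subdegree x \<ge> 0 \<Longrightarrow> fls_subdegree (fls_deriv x) \<ge> 0"
  unfolding fls_nonneg_iff by (auto simp: fls_deriv_fps_to_fls)

lemma fls_nonneg_sum:
  "(\<And>i. i \<in> I \<Longrightarrow> fls_subdegree (F i) \<ge> 0) \<Longrightarrow> fls_subdegree (\<Sum>i\<in>I. F i) \<ge> 0"
  by (induction I rule: infinite_finite_induct) (auto intro: fls_nonneg_add)

lemma fls_nonneg_power:
  fixes x :: "'a::comm_ring_1 fls"
  shows "fls_subdegree x \<ge> 0 \<Longrightarrow> fls_subdegree (x ^ n) \<ge> 0"
  by (induction n) (auto intro: fls_nonneg_mult)

lemma fls_nth_0_mult: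
  fixes x y :: "'a::comm_ring_1 fls"
  assumes "fls_subdegree x \<ge> 0" "fls_subdegree y \<ge> 0"
  shows "fls_nth (x * y) 0 = fls_nth x 0 * fls_nth y 0"
proof -
  obtain a b where "x = fps_to_fls a" "y = fps_to_fls b"
    using assms by (auto simp: fls_nonneg_iff)
  then show ?thesis by (simp flip: fls_times_fps_to_fls)
qed

lemma ev_nonneg: "fls_subdegree x \<ge> 0 \<Longrightarrow> fls_subdegree (ev p x) \<ge> 0"
  by (induction p) (auto intro: fls_nonneg_add fls_nonneg_mult)

lemma ev_nth_0: "fls_subdegree x \<ge> 0 \<Longrightarrow> fls_nth (ev p x) 0 = poly p (fls_nth x 0)"
  by (induction p) (simp_all add: fls_nth_0_mult ev_nonneg)

text \<open>Dividing by \<open>X powi (2 * k)\<close> leaves a power series with nonzero constant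
  coefficient, which has a radical over the complex numbers; the even order lets the shift be
  halved.\<close>

lemma fls_square_root:
  fixes y :: "complex fls"
  assumes "y \<noteq> 0" "fls_subdegree y = 2 * k"
  shows "\<exists>v. v\<^sup>2 = y"
proof -
  define X where "X = (fls_X :: complex fls)"
  have X: "X \<noteq> 0" "fls_subdegree X = 1"
    by (simp_all add: X_def)
  define z where "z = y * X powi (- 2 * k)"
  have z: "z \<noteq> 0" "fls_subdegree z = 0"
    using assms X by (simp_all add: z_def)
  then obtain u where u: "z = fps_to_fls u"
    using fls_nonneg_iff[of z] by auto
  have u0: "fps_nth u 0 \<noteq> 0"
    using z nth_fls_subdegree_nonzero[of z] u by simp
  define s where "s = fps_radical (\<lambda>_. csqrt) 2 u"
  have "csqrt (fps_nth u 0) * csqrt (fps_nth u 0) = fps_nth u 0"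
    by (metis power2_csqrt power2_eq_square)
  then have "s ^ 2 = u"
    using power_radical[of u "\<lambda>_. csqrt" 1] u0 by (simp add: s_def numeral_2_eq_2 power2_eq_square)
  then have "(fps_to_fls s)\<^sup>2 = z"
    using u by (simp flip: fps_to_fls_power)
  then have "(fps_to_fls s * X powi k)\<^sup>2 = z * X powi (2 * k)"
    by (simp add: power_mult_distrib power_int_mult mult.commute[of 2 k])
  also have "\<dots> = y"
    using X by (simp add: z_def power_int_minus)
  finally show ?thesis by blast
qed

text \<open>Passes to the coordinate \<open>inverse x\<close> at infinity. Since
  \<open>fls_const\<close> preserves the degree, reflecting commutes with mapping the
  coefficients.\<close>

lemma ev_reflect_poly: "x \<noteq> 0 \<Longrightarrow> ev (reflect_poly p) x = x ^ degree p * ev p (inverse x)"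
proof (cases "p = 0")
  case False
  assume "x \<noteq> 0"
  have d: "degree (map_poly fls_const p) = degree p"
    by (rule map_poly_degree_eq) (use False in simp)
  have "map_poly fls_const (reflect_poly p) = reflect_poly (map_poly fls_const p)"
    by (rule poly_eqI) (simp add: coeff_map_poly coeff_reflect_poly d)
  then show ?thesis
    using \<open>x \<noteq> 0\<close> by (simp add: ev_def poly_reflect_poly_nz d)
qed simp

text \<open>Both kinds of places are uniformised by a square root of a local parameter on the line, so
  that every rational function of \<open>t\<close> has even order, whether or not the place is ramified.\<close>

definition double_place :: "complex fls \<Rightarrow> (complex poly \<Rightarrow> int) \<Rightarrow> bool" where
  "double_place T v \<longleftrightarrow> (\<forall>p. p \<noteq> 0 \<longrightarrow> ev p T \<noteq> 0 \<and> fls_subdegree (ev p T) = 2 * v p)"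

text \<open>Split off all factors \<open>x - c\<close> of \<open>p\<close>: each becomes
  \<open>X^2\<close>, and the cofactor, nonzero at \<open>c\<close>, becomes a unit power
  series.\<close>

lemma double_place_finite: "double_place (fls_const c + fls_X\<^sup>2) (\<lambda>p. int (order c p))"
  unfolding double_place_def
proof (intro allI impI)
  fix p :: "complex poly" assume "p \<noteq> 0"
  then obtain q where p: "p = [:- c, 1:] ^ order c p * q" and q: "\<not> [:- c, 1:] dvd q"
    using order_decomp by blast
  define T where "T = fls_const c + (fls_X :: complex fls)\<^sup>2"
  have T: "fls_subdegree T \<ge> 0"
    unfolding T_def by (intro fls_nonneg_add fls_nonneg_power) simp_all
  have T0: "fls_nth T 0 = c"
    by (simp add: T_def power2_eq_square fls_nth_0_mult)
  have "fls_nth (ev q T) 0 \<noteq> 0"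
    using q by (simp add: ev_nth_0 T T0 poly_eq_0_iff_dvd)
  then have nz: "ev q T \<noteq> 0" and s: "fls_subdegree (ev q T) = 0"
    using ev_nonneg[OF T, of q] fls_subdegree_leI[of "ev q T" 0] by auto
  have "ev p T = fls_X ^ (2 * order c p) * ev q T"
    by (subst p) (simp add: T_def power_mult)
  then show "ev p (fls_const c + fls_X\<^sup>2) \<noteq> 0 \<and>
      fls_subdegree (ev p (fls_const c + fls_X\<^sup>2)) = 2 * int (order c p)"
    using nz s by (simp add: fls_subdegree_pow flip: T_def)
qed

text \<open>With \<open>x = X^2\<close>, the value \<open>p(1/x)\<close> is \<open>x\<close> to the
  power \<open>- degree p\<close> times the reflected polynomial at \<open>x\<close>, a unit because
  its constant coefficient is the leading coefficient of \<open>p\<close>.\<close>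

lemma double_place_infinite: "double_place (inverse (fls_X\<^sup>2)) (\<lambda>p. - int (degree p))"
  unfolding double_place_def
proof (intro allI impI)
  fix p :: "complex poly" assume p: "p \<noteq> 0"
  define x :: "complex fls" where "x = fls_X\<^sup>2"
  have x: "x \<noteq> 0" "fls_subdegree x = 2" "fls_nth x 0 = 0"
    by (simp_all add: x_def power2_eq_square fls_nth_0_mult)
  have "fls_nth (ev (reflect_poly p) x) 0 \<noteq> 0"
    using p x by (simp add: ev_nth_0)
  then have nz: "ev (reflect_poly p) x \<noteq> 0" and s: "fls_subdegree (ev (reflect_poly p) x) = 0"
    using ev_nonneg[of x "reflect_poly p"] fls_subdegree_leI[of "ev (reflect_poly p) x" 0] x
    by auto
  have e: "ev (reflect_poly p) x = x ^ degree p * ev p (inverse x)"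
    using x by (simp add: ev_reflect_poly)
  then have "ev p (inverse x) \<noteq> 0"
    using nz by auto
  moreover from this have "fls_subdegree (ev p (inverse x)) = 2 * - int (degree p)"
    using s x e by (simp add: fls_subdegree_pow)
  ultimately show "ev p (inverse (fls_X\<^sup>2)) \<noteq> 0 \<and>
      fls_subdegree (ev p (inverse (fls_X\<^sup>2))) = 2 * - int (degree p)"
    by (simp add: x_def)
qed

lemma double_place_nonconst: 
  assumes "double_place T v" shows "T \<notin> range fls_const"
proof
  assume "T \<in> range fls_const"
  then obtain c where "ev [:- c, 1:] T = 0" by auto
  with assms show False unfolding double_place_def by (metis one_neq_zero pCons_eq_0_iff)
qed

section \<open>Models of a hyperelliptic field, transport between them, and place rings\<close>

definition model :: "complex poly \<Rightarrow> complex fls \<Rightarrow> complex fls \<Rightarrow> bool" where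
  "model f t w \<longleftrightarrow> w\<^sup>2 = ev f t \<and> t \<notin> range fls_const"

lemma model_uminus: "model f t w \<Longrightarrow> model f t (- w)"
  by (simp add: model_def)

text \<open>At a double place \<open>ev f T\<close> has even order, hence a square root, whether or
  not the point is a branch point.\<close>

lemma model_exists:
  assumes "double_place T v" "f \<noteq> 0"
  obtains V where "model f T V"
  using assms fls_square_root[of "ev f T" "v f"] double_place_nonconst[OF assms(1)]
  by (auto simp: model_def double_place_def)

lemma deriv_nonzero: "t \<notin> range fls_const \<Longrightarrow> fls_deriv (t :: complex fls) \<noteq> 0"
  using fls_deriv_eq_0_iff[of t] by auto

text \<open>For two models of the same \<open>f\<close> this is the field isomorphism sending
  \<open>t\<close> to \<open>T\<close> and \<open>w\<close> to \<open>V\<close>. \<open>SOME\<close>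
  picks a representing fraction; \<open>transport_eq\<close> shows that the choice does not
  matter.\<close>

definition transport ::
    "complex fls \<Rightarrow> complex fls \<Rightarrow> complex fls \<Rightarrow> complex fls \<Rightarrow> complex fls \<Rightarrow> complex fls" where
  "transport t w T V x = (SOME y. \<exists>p r. x = eval2 p t w / eval2 r t w \<and> eval2 r t w \<noteq> 0 \<and>
     y = eval2 p T V / eval2 r T V)"

text \<open>The valuation ring of the place given by the embedding \<open>(T, V)\<close>: the
  preimage of the power series.\<close>

definition place_ring ::
    "complex fls \<Rightarrow> complex fls \<Rightarrow> complex fls \<Rightarrow> complex fls \<Rightarrow> complex fls set" where
  "place_ring t w T V = {x \<in> generated_field t w. fls_subdegree (transport t w T V x) \<ge> 0}"

text \<open>\<open>g\<close> will be the genus of \<open>w^2 = f(t)\<close>. The odd degree makes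
  infinity a branch point with a single place over it.\<close>

locale hyperelliptic =
  fixes f :: "complex poly" and g :: nat
  assumes sqfree: "rsquarefree f" and deg: "degree f = 2 * g + 1"
begin

lemma f_nonzero: "f \<noteq> 0"
  using deg by auto

text \<open>Replace \<open>w^2\<close> by \<open>f\<close>. The quantifiers matter:
  \<open>p0\<close> and \<open>p1\<close> depend on \<open>p\<close> only, so one reduction serves
  all models.\<close>

lemma eval2_reduce:
  "\<exists>p0 p1. \<forall>t w. w\<^sup>2 = ev f t \<longrightarrow> eval2 p t w = ev p0 t + ev p1 t * w"
proof (induction p)
  case 0
  show ?case by (rule exI[of _ 0], rule exI[of _ 0]) simp
next
  case (pCons c p)
  then obtain p0 p1 where p: "w\<^sup>2 = ev f t \<Longrightarrow> eval2 p t w = ev p0 t + ev p1 t * w" for t w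
    by blast
  show ?case
    by (rule exI[of _ "c + f * p1"], rule exI[of _ p0])
      (auto simp: p algebra_simps power2_eq_square)
qed

text \<open>A relation would give \<open>p0^2 = p1^2 * f\<close>, impossible for nonzero
  \<open>p1\<close> by parity, because \<open>f\<close> has odd degree.\<close>

lemma model_independent:
  assumes "model f t w"
  shows "ev p0 t + ev p1 t * w = 0 \<longleftrightarrow> p0 = 0 \<and> p1 = 0"
proof
  assume "ev p0 t + ev p1 t * w = 0"
  then have "ev p0 t = - (ev p1 t * w)"
    by (simp add: eq_neg_iff_add_eq_0)
  then have "(ev p0 t)\<^sup>2 = (ev p1 t)\<^sup>2 * w\<^sup>2"
    by (simp add: power_mult_distrib)
  then have "ev (p0\<^sup>2 - p1\<^sup>2 * f) t = 0"
    using assms by (simp add: model_def)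
  then have eq: "p0\<^sup>2 = p1\<^sup>2 * f"
    using assms ev_eq_0_iff[of t "p0\<^sup>2 - p1\<^sup>2 * f"] by (simp add: model_def)
  have "p1 = 0"
  proof (rule ccontr)
    assume "p1 \<noteq> 0"
    then have "p0 \<noteq> 0" using eq f_nonzero by auto
    have "2 * degree p0 = 2 * degree p1 + degree f"
      using arg_cong[OF eq, of degree] \<open>p1 \<noteq> 0\<close> f_nonzero \<open>p0 \<noteq> 0\<close>
      by (simp add: degree_mult_eq degree_power_eq)
    then show False using deg by presburger
  qed
  with eq show "p0 = 0 \<and> p1 = 0" by simp
qed simp

text \<open>Vanishing is decided by the reduced form alone, so all models satisfy the same
  polynomial relations. This makes \<open>transport\<close> well defined.\<close>

lemma eval2_eq_0_transfer:
  assumes "model f t w" "model f T V"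
  shows "eval2 p t w = 0 \<longleftrightarrow> eval2 p T V = 0"
proof -
  obtain p0 p1 where "w\<^sup>2 = ev f t \<Longrightarrow> eval2 p t w = ev p0 t + ev p1 t * w" for t w
    using eval2_reduce[of p] by blast
  then show ?thesis
    using assms model_independent[of t w p0 p1] model_independent[of T V p0 p1]
    by (simp add: model_def)
qed

lemma transport_eq:
  assumes "model f t w" "model f T V" "eval2 r t w \<noteq> 0"
  shows "transport t w T V (eval2 p t w / eval2 r t w) = eval2 p T V / eval2 r T V"
  unfolding transport_def
proof (rule some_equality)
  fix y assume "\<exists>p' r'. eval2 p t w / eval2 r t w = eval2 p' t w / eval2 r' t w \<and>
    eval2 r' t w \<noteq> 0 \<and> y = eval2 p' T V / eval2 r' T V"
  then obtain p' r' where e: "eval2 p t w / eval2 r t w = eval2 p' t w / eval2 r' t w"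
    and r': "eval2 r' t w \<noteq> 0" and y: "y = eval2 p' T V / eval2 r' T V"
    by blast
  have "eval2 (p * r' - p' * r) t w = 0"
    using e r' assms(3) by (simp add: frac_eq_eq)
  then have "eval2 (p * r' - p' * r) T V = 0"
    using eval2_eq_0_transfer assms by blast
  moreover have "eval2 r T V \<noteq> 0" "eval2 r' T V \<noteq> 0"
    using eval2_eq_0_transfer assms r' by blast+
  ultimately show "y = eval2 p T V / eval2 r T V"
    using y by (simp add: frac_eq_eq)
qed (use assms in blast)

context
  fixes t w T V
  assumes mt: "model f t w" and mT: "model f T V"
begin

lemma field_elemE:
  assumes "x \<in> generated_field t w"
  obtains p r where "x = eval2 p t w / eval2 r t w" "eval2 r t w \<noteq> 0" "eval2 r T V \<noteq> 0"
    "transport t w T V x = eval2 p T V / eval2 r T V"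
  using assms transport_eq[OF mt mT] eval2_eq_0_transfer[OF mt mT]
  unfolding generated_field_def by blast

lemma transport_eval2: "transport t w T V (eval2 p t w) = eval2 p T V"
  using transport_eq[OF mt mT, of 1 p] by simp

lemma transport_const: "transport t w T V (fls_const c) = fls_const c"
  using transport_eval2[of "Const c"] by simp

lemma transport_t: "transport t w T V t = T"
  using transport_eval2[of Z] by simp

lemma transport_w: "transport t w T V w = V"
  using transport_eval2[of Y] by simp

lemma transport_diff:
  assumes "x \<in> generated_field t w" "y \<in> generated_field t w"
  shows "transport t w T V (x - y) = transport t w T V x - transport t w T V y"
proof -
  obtain p r where x: "x = eval2 p t w / eval2 r t w" "eval2 r t w \<noteq> 0" "eval2 r T V \<noteq> 0"
    "transport t w T V x = eval2 p T V / eval2 r T V"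
    using assms(1) by (rule field_elemE)
  obtain p' r' where y: "y = eval2 p' t w / eval2 r' t w" "eval2 r' t w \<noteq> 0" "eval2 r' T V \<noteq> 0"
    "transport t w T V y = eval2 p' T V / eval2 r' T V"
    using assms(2) by (rule field_elemE)
  show ?thesis
    using transport_eq[OF mt mT, of "r * r'" "p * r' - p' * r"] x y
    by (simp add: diff_frac_eq)
qed

lemma transport_mult:
  assumes "x \<in> generated_field t w" "y \<in> generated_field t w"
  shows "transport t w T V (x * y) = transport t w T V x * transport t w T V y"
proof -
  obtain p r where x: "x = eval2 p t w / eval2 r t w" "eval2 r t w \<noteq> 0" "eval2 r T V \<noteq> 0"
    "transport t w T V x = eval2 p T V / eval2 r T V"
    using assms(1) by (rule field_elemE)
  obtain p' r' where y: "y = eval2 p' t w / eval2 r' t w" "eval2 r' t w \<noteq> 0" "eval2 r' T V \<noteq> 0"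
    "transport t w T V y = eval2 p' T V / eval2 r' T V"
    using assms(2) by (rule field_elemE)
  show ?thesis
    using transport_eq[OF mt mT, of "r * r'" "p * p'"] x y by simp
qed

lemma transport_add:
  assumes "x \<in> generated_field t w" "y \<in> generated_field t w"
  shows "transport t w T V (x + y) = transport t w T V x + transport t w T V y"
proof -
  have m: "- y \<in> generated_field t w"
    using subfield_generated_field assms(2) by (rule subfield_uminus)
  have "transport t w T V (0 - y) = 0 - transport t w T V y"
    using transport_diff[OF subfield_0[OF subfield_generated_field] assms(2)]
      transport_const[of 0] by simp
  then show ?thesis
    using transport_diff[OF assms(1) m] by simp
qed

lemma transport_sum:
  assumes "\<And>i. i \<in> I \<Longrightarrow> F i \<in> generated_field t w"
  shows "(\<Sum>i\<in>I. F i) \<in> generated_field t w \<and>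
    transport t w T V (\<Sum>i\<in>I. F i) = (\<Sum>i\<in>I. transport t w T V (F i))"
  using assms
proof (induction I rule: infinite_finite_induct)
  case (insert i I)
  then show ?case
    by (simp add: transport_add subfield_add[OF subfield_generated_field])
qed (use transport_const[of 0] subfield_0[OF subfield_generated_field] in auto)

lemma transport_inverse:
  assumes "x \<in> generated_field t w"
  shows "transport t w T V (inverse x) = inverse (transport t w T V x)"
proof (cases "x = 0")
  case True
  then show ?thesis using transport_const[of 0] by simp
next
  case False
  have "inverse x \<in> generated_field t w"
    using subfield_generated_field assms by (rule subfield_inverse)
  then have "transport t w T V x * transport t w T V (inverse x) = 1"
    using transport_mult[OF assms, of "inverse x"] False transport_const[of 1] by simp
  then show ?thesis by (metis inverse_unique)
qed

text \<open>The quotient \<open>d = dx/dt\<close> lies in the field and is intrinsic to it, so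
  transport respects it. The elements for which this holds form a subfield containing
  \<open>t\<close> and \<open>w\<close>.\<close>

lemma field_derivative:
  assumes "x \<in> generated_field t w"
  shows "\<exists>d\<in>generated_field t w. fls_deriv x = d * fls_deriv t \<and>
    fls_deriv (transport t w T V x) = transport t w T V d * fls_deriv T"
proof -
  let ?K = "generated_field t w" and ?\<psi> = "transport t w T V"
  note K = subfield_intros[OF subfield_generated_field]
  define L where "L = {x \<in> ?K. \<exists>d\<in>?K. fls_deriv x = d * fls_deriv t \<and>
    fls_deriv (?\<psi> x) = ?\<psi> d * fls_deriv T}"
  have "subfield L"
    unfolding subfield_def
  proof (intro conjI ballI)
    show "range fls_const \<subseteq> L"
      using K(1,2) transport_const transport_const[of 0] by (force simp: L_def intro!: bexI[of _ 0])
  next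
    fix x y assume "x \<in> L" "y \<in> L"
    then obtain d e where x: "x \<in> ?K" "d \<in> ?K" "fls_deriv x = d * fls_deriv t"
      "fls_deriv (?\<psi> x) = ?\<psi> d * fls_deriv T"
      and y: "y \<in> ?K" "e \<in> ?K" "fls_deriv y = e * fls_deriv t"
      "fls_deriv (?\<psi> y) = ?\<psi> e * fls_deriv T"
      by (auto simp: L_def)
    have "d - e \<in> ?K" "x - y \<in> ?K" using x y by (auto intro: K)
    moreover have "fls_deriv (x - y) = (d - e) * fls_deriv t"
      "fls_deriv (?\<psi> (x - y)) = ?\<psi> (d - e) * fls_deriv T"
      using x y by (simp_all add: transport_diff algebra_simps)
    ultimately show "x - y \<in> L"
      unfolding L_def by blast
    have "x * e + y * d \<in> ?K" "x * y \<in> ?K" using x y by (auto intro: K)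
    moreover have "fls_deriv (x * y) = (x * e + y * d) * fls_deriv t"
      using x y by (simp add: algebra_simps)
    moreover have "?\<psi> (x * e + y * d) = ?\<psi> x * ?\<psi> e + ?\<psi> y * ?\<psi> d"
      using x y by (simp add: transport_add transport_mult K)
    then have "fls_deriv (?\<psi> (x * y)) = ?\<psi> (x * e + y * d) * fls_deriv T"
      using x y by (simp add: transport_mult algebra_simps)
    ultimately show "x * y \<in> L"
      unfolding L_def by blast
  next
    fix x assume "x \<in> L"
    then obtain d where x: "x \<in> ?K" "d \<in> ?K" "fls_deriv x = d * fls_deriv t"
      "fls_deriv (?\<psi> x) = ?\<psi> d * fls_deriv T"
      by (auto simp: L_def)
    have e: "- (d * inverse x ^ 2) \<in> ?K" using x by (auto intro: K)
    have "?\<psi> (0 - d * (inverse x * inverse x)) = 0 - ?\<psi> d * (inverse (?\<psi> x) * inverse (?\<psi> x))"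
      using x transport_const[of 0] by (simp only: transport_diff transport_mult transport_inverse K) simp
    then have e': "?\<psi> (- (d * inverse x ^ 2)) = - (?\<psi> d * inverse (?\<psi> x) ^ 2)"
      by (simp add: power2_eq_square)
    have "fls_deriv (inverse x) = - (d * inverse x ^ 2) * fls_deriv t"
      "fls_deriv (inverse (?\<psi> x)) = - (?\<psi> d * inverse (?\<psi> x) ^ 2) * fls_deriv T"
      using x by (simp_all add: fls_inverse_deriv algebra_simps)
    then show "inverse x \<in> L"
      using x e e' unfolding L_def
      by (auto simp: transport_inverse K intro!: bexI[of _ "- (d * inverse x ^ 2)"])
  qed
  moreover have "t \<in> L"
    using transport_const[of 1] generators_in_generated_field K(3)
    by (auto simp: L_def transport_t intro!: bexI[of _ 1])
  moreover have "w \<in> L"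
  proof -
    \<comment> \<open>Differentiating \<open>w^2 = f(t)\<close> forces
      \<open>dw/dt = f'(t) / (2 w)\<close>; the \<open>eval2\<close> form makes it a fraction to
      which \<open>transport_eq\<close> applies.\<close>
    define d where "d = eval2 [:pderiv f:] t w / eval2 [:0, 2:] t w"
    have nz: "w \<noteq> 0" "V \<noteq> 0"
      using mt mT f_nonzero ev_eq_0_iff by (auto simp: model_def)
    have "2 * w * fls_deriv w = ev (pderiv f) t * fls_deriv t" if "model f t w" for t w
    proof -
      have "fls_deriv (w * w) = fls_deriv (ev f t)"
        using that by (simp add: model_def power2_eq_square)
      then show ?thesis
        by (simp add: ev_deriv mult.assoc)
    qed
    note dv = this[OF mt] this[OF mT]
    have d: "d = ev (pderiv f) t / (2 * w)"
      by (simp add: d_def)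
    have "?\<psi> d = eval2 [:pderiv f:] T V / eval2 [:0, 2:] T V"
      unfolding d_def by (rule transport_eq[OF mt mT]) (use nz in simp)
    then have "?\<psi> d = ev (pderiv f) T / (2 * V)"
      by simp
    moreover have "d \<in> ?K"
      unfolding d_def by (rule generated_fieldI) (use nz in simp)
    moreover have "fls_deriv w = d * fls_deriv t" "fls_deriv V = ev (pderiv f) T / (2 * V) * fls_deriv T"
      using dv nz by (simp_all add: d field_simps)
    ultimately show ?thesis
      using generators_in_generated_field unfolding L_def by (auto simp: transport_w)
  qed
  ultimately have "?K \<subseteq> L" by (rule generated_field_least)
  then show ?thesis using assms by (auto simp: L_def)
qed

text \<open>The element \<open>u\<close> of positive order makes both inclusions strict: it is
  nonconstant and in the ring, and its inverse is outside.\<close>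

lemma place_ring_valuation:
  assumes "u \<in> generated_field t w" "transport t w T V u \<noteq> 0"
    "fls_subdegree (transport t w T V u) > 0"
  shows "place_ring t w T V \<in> valuation_rings (generated_field t w)"
proof -
  let ?K = "generated_field t w" and ?R = "place_ring t w T V" and ?\<psi> = "transport t w T V"
  note K = subfield_intros[OF subfield_generated_field]
  have "range fls_const \<subseteq> ?R"
    using K(1) by (auto simp: place_ring_def transport_const)
  moreover have "u \<in> ?R" using assms by (simp add: place_ring_def)
  moreover have "u \<notin> range fls_const"
    using assms(3) by (auto simp: transport_const)
  moreover have "inverse u \<in> ?K" "inverse u \<notin> ?R"
    using assms by (auto simp: place_ring_def transport_inverse intro: K)
  moreover have "x - y \<in> ?R \<and> x * y \<in> ?R" if "x \<in> ?R" "y \<in> ?R" for x y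
    using that by (auto simp: place_ring_def transport_diff transport_mult
        intro: K fls_nonneg_diff fls_nonneg_mult)
  moreover have "x \<in> ?R \<or> inverse x \<in> ?R" if "x \<in> ?K" for x
    using that by (auto simp: place_ring_def transport_inverse intro: K)
  ultimately show ?thesis
    unfolding valuation_rings_def place_ring_def by blast
qed

text \<open>Dividing \<Sum> \<open>F i * d(h i)\<close> by \<open>dt\<close> gives an identity in
  the field, which can be transported; afterwards every \<open>F i\<close> and \<open>h i\<close> is
  a power series, so the sum has no pole.\<close>

lemma place_ring_differentials:
  assumes "\<phi> \<in> generated_field t w" "\<phi> * fls_deriv t \<in> differentials (place_ring t w T V)"
  shows "fls_subdegree (transport t w T V \<phi> * fls_deriv T) \<ge> 0"
proof -
  let ?K = "generated_field t w" and ?R = "place_ring t w T V" and ?\<psi> = "transport t w T V"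
  note K = subfield_intros[OF subfield_generated_field]
  obtain n :: nat and F h where eq: "\<phi> * fls_deriv t = (\<Sum>i<n. F i * fls_deriv (h i))"
    and Fh: "\<forall>i<n. F i \<in> ?R \<and> h i \<in> ?R"
    using assms(2) unfolding differentials_def mem_Collect_eq by blast
  have FK: "F i \<in> ?K" "h i \<in> ?K" if "i < n" for i
    using Fh that by (simp_all add: place_ring_def)
  have "\<forall>x\<in>?K. \<exists>d. d \<in> ?K \<and> fls_deriv x = d * fls_deriv t \<and>
      fls_deriv (?\<psi> x) = ?\<psi> d * fls_deriv T"
    using field_derivative by blast
  then obtain D where D: "\<forall>x\<in>?K. D x \<in> ?K \<and> fls_deriv x = D x * fls_deriv t \<and>
      fls_deriv (?\<psi> x) = ?\<psi> (D x) * fls_deriv T"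
    by (rule bchoice[THEN exE])
  have d: "D (h i) \<in> ?K" "fls_deriv (h i) = D (h i) * fls_deriv t"
      "fls_deriv (?\<psi> (h i)) = ?\<psi> (D (h i)) * fls_deriv T" if "i < n" for i
    using D FK(2)[OF that] by auto
  have "\<phi> * fls_deriv t = (\<Sum>i<n. F i * D (h i)) * fls_deriv t"
    unfolding eq sum_distrib_right by (rule sum.cong) (simp_all add: d(2) mult.assoc)
  then have \<phi>: "\<phi> = (\<Sum>i<n. F i * D (h i))"
    using deriv_nonzero[of t] mt by (simp add: model_def)
  have "?\<psi> \<phi> = (\<Sum>i<n. ?\<psi> (F i * D (h i)))"
    unfolding \<phi> using transport_sum[of "{..<n}" "\<lambda>i. F i * D (h i)"] FK d(1) by (simp add: K)
  then have "?\<psi> \<phi> * fls_deriv T = (\<Sum>i<n. ?\<psi> (F i * D (h i)) * fls_deriv T)"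
    by (simp only: sum_distrib_right)
  also have "\<dots> = (\<Sum>i<n. ?\<psi> (F i) * fls_deriv (?\<psi> (h i)))"
    by (rule sum.cong) (simp_all add: d(3) d(1) FK transport_mult mult.assoc)
  finally have "?\<psi> \<phi> * fls_deriv T = (\<Sum>i<n. ?\<psi> (F i) * fls_deriv (?\<psi> (h i)))" .
  moreover have "fls_subdegree (?\<psi> (F i) * fls_deriv (?\<psi> (h i))) \<ge> 0" if "i < n" for i
    using Fh that unfolding place_ring_def
    by (intro fls_nonneg_mult fls_nonneg_deriv) auto
  ultimately show ?thesis
    using fls_nonneg_sum[of "{..<n}" "\<lambda>i. ?\<psi> (F i) * fls_deriv (?\<psi> (h i))"] by simp
qed

end

end

section \<open>Regular differentials\<close>

context hyperelliptic
begin

text \<open>Fractions are rationalised by the conjugate \<open>p0 - p1 w\<close>: the norm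
  \<open>p0^2 - p1^2 f\<close> is a nonzero polynomial in \<open>t\<close> by
  \<open>model_independent\<close>.\<close>

lemma field_normal_form:
  assumes m: "model f t w" and "x \<in> generated_field t w"
  shows "\<exists>p0 p1 r. r \<noteq> 0 \<and> x * ev r t = ev p0 t + ev p1 t * w"
proof -
  define L where "L = {x. \<exists>p0 p1 r. r \<noteq> 0 \<and> x * ev r t = ev p0 t + ev p1 t * w}"
  have w2: "w * w = ev f t"
    using m by (simp add: model_def power2_eq_square)
  have LI: "x \<in> L" if "r \<noteq> 0" "x * ev r t = ev p0 t + ev p1 t * w" for x p0 p1 r
    using that unfolding L_def by blast
  have "subfield L"
    unfolding subfield_def
  proof (intro conjI ballI)
    show "range fls_const \<subseteq> L"
      using LI[of 1 "fls_const c" "[:c:]" 0 for c] by auto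
  next
    fix x y assume "x \<in> L" "y \<in> L"
    then obtain p0 p1 r q0 q1 s where r: "r \<noteq> 0" and x: "x * ev r t = ev p0 t + ev p1 t * w"
      and s: "s \<noteq> 0" and y: "y * ev s t = ev q0 t + ev q1 t * w"
      by (auto simp: L_def)
    have "(x - y) * ev (r * s) t = (x * ev r t) * ev s t - (y * ev s t) * ev r t"
      by (simp add: algebra_simps)
    also have "\<dots> = ev (p0 * s - q0 * r) t + ev (p1 * s - q1 * r) t * w"
      unfolding x y by (simp add: algebra_simps)
    finally show "x - y \<in> L"
      using r s LI[of "r * s" "x - y" "p0 * s - q0 * r" "p1 * s - q1 * r"] by simp
    have "(x * y) * ev (r * s) t = (x * ev r t) * (y * ev s t)"
      by (simp add: algebra_simps)
    also have "\<dots> = ev (p0 * q0 + p1 * q1 * f) t + ev (p0 * q1 + p1 * q0) t * w"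
      unfolding x y by (simp add: algebra_simps flip: w2)
    finally show "x * y \<in> L"
      using r s LI[of "r * s" "x * y" "p0 * q0 + p1 * q1 * f" "p0 * q1 + p1 * q0"] by simp
  next
    fix x assume "x \<in> L"
    then obtain p0 p1 r where r: "r \<noteq> 0" and x: "x * ev r t = ev p0 t + ev p1 t * w"
      by (auto simp: L_def)
    show "inverse x \<in> L"
    proof (cases "x = 0")
      case True
      then show ?thesis using \<open>x \<in> L\<close> by simp
    next
      case False
      define N where "N = p0\<^sup>2 - p1\<^sup>2 * f"
      have N: "ev N t = (ev p0 t + ev p1 t * w) * (ev p0 t - ev p1 t * w)"
        by (simp add: N_def algebra_simps power2_eq_square flip: w2)
      have "x * ev r t \<noteq> 0"
        using False r m ev_eq_0_iff by (simp add: model_def)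
      then have "\<not> (p0 = 0 \<and> p1 = 0)"
        unfolding x by auto
      then have "ev p0 t - ev p1 t * w \<noteq> 0" "ev p0 t + ev p1 t * w \<noteq> 0"
        using model_independent[OF m, of p0 "- p1"] model_independent[OF m, of p0 p1] by auto
      then have "N \<noteq> 0"
        using N by auto
      moreover have "inverse x * ev N t = ev (r * p0) t + ev (- (r * p1)) t * w"
      proof -
        have "inverse x * ev N t = inverse x * x * ev r t * (ev p0 t - ev p1 t * w)"
          unfolding N x[symmetric] by (simp add: mult_ac)
        then show ?thesis using False by (simp add: algebra_simps)
      qed
      ultimately show ?thesis by (rule LI)
    qed
  qed
  moreover have "t \<in> L" "w \<in> L"
    by (rule LI[of 1 _ "[:0, 1:]" 0], simp_all) (rule LI[of 1 _ 0 1], simp_all)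
  ultimately show ?thesis
    using generated_field_least[of L t w] assms(2) by (auto simp: L_def)
qed

text \<open>The orders of the two parts of \<open>\<phi> w\<close> are bounded separately by comparing the differential
  at a place with its image under the hyperelliptic involution.\<close>

lemma regular_at_double_place:
  assumes m: "model f t w" and T: "double_place T v"
    and u: "u \<in> generated_field t w"
      "\<And>V. model f T V \<Longrightarrow> transport t w T V u \<noteq> 0 \<and> fls_subdegree (transport t w T V u) > 0"
    and \<phi>: "\<phi> \<in> generated_field t w" "\<phi> * fls_deriv t \<in> regular_differentials (generated_field t w)"
    and r: "r \<noteq> 0" and eq: "\<phi> * w * ev r t = ev p0 t + ev p1 t * w"
  shows "p0 \<noteq> 0 \<Longrightarrow> fls_subdegree (fls_deriv T) + 2 * v p0 \<ge> v f + 2 * v r"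
    and "p1 \<noteq> 0 \<Longrightarrow> fls_subdegree (fls_deriv T) + 2 * v p1 \<ge> 2 * v r"
proof -
  obtain V where mV: "model f T V"
    using model_exists[OF T f_nonzero] .
  let ?K = "generated_field t w"
  note K = subfield_intros[OF subfield_generated_field]
  have T': "fls_deriv T \<noteq> 0"
    using deriv_nonzero double_place_nonconst[OF T] .
  have key: "fls_subdegree (transport t w T V \<phi> * fls_deriv T) \<ge> 0 \<and>
      transport t w T V \<phi> * V * ev r T = ev p0 T + ev p1 T * V" if mV: "model f T V" for V
  proof
    let ?\<psi> = "transport t w T V"
    have "place_ring t w T V \<in> valuation_rings ?K"
      using place_ring_valuation[OF m mV] u mV by blast
    then show "fls_subdegree (?\<psi> \<phi> * fls_deriv T) \<ge> 0"
      using \<phi> by (intro place_ring_differentials[OF m mV]) (auto simp: regular_differentials_def)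
    have ev: "?\<psi> (ev p t) = ev p T" "ev p t \<in> ?K" for p
      using transport_eval2[OF m mV, of "[:p:]"] eval2_in_generated_field[of "[:p:]" t w] by simp_all
    have "?\<psi> (\<phi> * w * ev r t) = ?\<psi> (ev p0 t + ev p1 t * w)"
      by (simp add: eq)
    then show "?\<psi> \<phi> * V * ev r T = ev p0 T + ev p1 T * V"
      using \<phi> ev generators_in_generated_field
      by (simp add: transport_mult[OF m mV] transport_add[OF m mV] transport_w[OF m mV] K)
  qed
  \<comment> \<open>\<open>a\<close> and \<open>b\<close> are the differential at the conjugate
    embeddings \<open>V\<close> and \<open>- V\<close>. In the sums below, \<open>a - b\<close>
    isolates \<open>p0\<close> and \<open>a + b\<close> isolates \<open>p1\<close>.\<close>
  define a where "a = transport t w T V \<phi> * fls_deriv T"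
  define b where "b = transport t w T (- V) \<phi> * fls_deriv T"
  have ab: "fls_subdegree a \<ge> 0" "fls_subdegree b \<ge> 0"
    using key[OF mV] key[OF model_uminus[OF mV]] by (simp_all add: a_def b_def)
  have "(transport t w T V' \<phi> * fls_deriv T) * V' * ev r T =
      (transport t w T V' \<phi> * V' * ev r T) * fls_deriv T" for V'
    by (simp add: mult_ac)
  from this[of V] this[of "- V"]
  have a: "a * V * ev r T = (ev p0 T + ev p1 T * V) * fls_deriv T"
    and b: "b * - V * ev r T = (ev p0 T + ev p1 T * - V) * fls_deriv T"
    using key[OF mV] key[OF model_uminus[OF mV]] by (simp_all only: a_def b_def)
  have V: "V \<noteq> 0" "fls_subdegree V = v f"
  proof -
    have "V * V = ev f T" using mV by (simp add: model_def power2_eq_square)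
    moreover have "ev f T \<noteq> 0" "fls_subdegree (ev f T) = 2 * v f"
      using T f_nonzero by (auto simp: double_place_def)
    ultimately show "V \<noteq> 0" "fls_subdegree V = v f"
      using fls_subdegree_mult[of V V] by (fastforce, fastforce)
  qed
  have R: "ev r T \<noteq> 0" "fls_subdegree (ev r T) = 2 * v r"
    using T r by (auto simp: double_place_def)
  show "fls_subdegree (fls_deriv T) + 2 * v p0 \<ge> v f + 2 * v r" if p0: "p0 \<noteq> 0"
  proof -
    have P: "ev p0 T \<noteq> 0" "fls_subdegree (ev p0 T) = 2 * v p0"
      using T p0 by (auto simp: double_place_def)
    have e: "(a - b) * V * ev r T = 2 * ev p0 T * fls_deriv T"
      using a b by (simp add: algebra_simps)
    then have "a - b \<noteq> 0"
      using P T' by auto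
    then have "fls_subdegree (a - b) + v f + 2 * v r = 2 * v p0 + fls_subdegree (fls_deriv T)"
      using arg_cong[OF e, of fls_subdegree] V R P T' by simp
    with fls_nonneg_diff[OF ab] show ?thesis by simp
  qed
  show "fls_subdegree (fls_deriv T) + 2 * v p1 \<ge> 2 * v r" if p1: "p1 \<noteq> 0"
  proof -
    have P: "ev p1 T \<noteq> 0" "fls_subdegree (ev p1 T) = 2 * v p1"
      using T p1 by (auto simp: double_place_def)
    have "(a + b) * ev r T * V = a * V * ev r T - b * - V * ev r T"
      by (simp add: algebra_simps)
    also have "\<dots> = 2 * ev p1 T * fls_deriv T * V"
      unfolding a b by (simp add: algebra_simps)
    finally have "(a + b) * ev r T * V = 2 * ev p1 T * fls_deriv T * V" .
    then have e: "(a + b) * ev r T = 2 * ev p1 T * fls_deriv T"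
      using V by simp
    then have "a + b \<noteq> 0"
      using P T' by auto
    then have "fls_subdegree (a + b) + 2 * v r = 2 * v p1 + fls_subdegree (fls_deriv T)"
      using arg_cong[OF e, of fls_subdegree] R P T' by simp
    with fls_nonneg_add[OF ab] show ?thesis by simp
  qed
qed

text \<open>Take a denominator \<open>r\<close> of \<open>\<phi> * w\<close> of least degree.
  Regularity over a root of \<open>r\<close> would let the fraction be reduced, so \<open>r\<close>
  is constant; regularity at infinity then kills \<open>p1\<close> and bounds
  \<open>degree p0\<close>.\<close>

lemma regular_differential_form:
  assumes m: "model f t w" and "\<omega> \<in> regular_differentials (generated_field t w)"
  shows "\<exists>p. (p = 0 \<or> degree p < g) \<and> \<omega> = ev p t * fls_deriv t / w"
proof -
  let ?K = "generated_field t w"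
  note K = subfield_intros[OF subfield_generated_field]
  have w: "w \<noteq> 0"
    using m f_nonzero ev_eq_0_iff by (auto simp: model_def)
  have "\<omega> \<in> differentials ?K"
    using assms(2) by (simp add: regular_differentials_def)
  then obtain n :: nat and F h where \<omega>: "\<omega> = (\<Sum>i<n. F i * fls_deriv (h i))"
    and Fh: "\<forall>i<n. F i \<in> ?K \<and> h i \<in> ?K"
    unfolding differentials_def by blast
  have "(\<Sum>i<n. F i * fls_deriv (h i)) \<in> {\<phi> * fls_deriv t | \<phi>. \<phi> \<in> ?K}"
    using Fh
  proof (induction n)
    case 0
    then show ?case using K(2) by auto
  next
    case (Suc n)
    then obtain \<phi> where \<phi>: "\<phi> \<in> ?K" "(\<Sum>i<n. F i * fls_deriv (h i)) = \<phi> * fls_deriv t"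
      by auto
    obtain d where "d \<in> ?K" "fls_deriv (h n) = d * fls_deriv t"
      using Suc field_derivative[OF m m, of "h n"] by blast
    with \<phi> Suc have "\<phi> + F n * d \<in> ?K"
      "(\<Sum>i<Suc n. F i * fls_deriv (h i)) = (\<phi> + F n * d) * fls_deriv t"
      by (auto simp: algebra_simps intro: K)
    then show ?case by blast
  qed
  then obtain \<phi> where \<phi>: "\<phi> \<in> ?K" and \<omega>': "\<omega> = \<phi> * fls_deriv t"
    using \<omega> by blast
  have "\<phi> * w \<in> ?K"
    using \<phi> generators_in_generated_field by (auto intro: K)
  define P where "P r \<longleftrightarrow> r \<noteq> 0 \<and> (\<exists>p0 p1. \<phi> * w * ev r t = ev p0 t + ev p1 t * w)" for r
  have "\<exists>r. P r"
    using field_normal_form[OF m \<open>\<phi> * w \<in> ?K\<close>] unfolding P_def by blast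
  then obtain r where "P r" and min: "\<And>s. P s \<Longrightarrow> degree r \<le> degree s"
    using ex_has_least_nat[of P _ degree] by metis
  then obtain p0 p1 where r: "r \<noteq> 0" and eq: "\<phi> * w * ev r t = ev p0 t + ev p1 t * w"
    unfolding P_def by blast
  note bound = regular_at_double_place[OF m _ _ _ \<phi> assms(2)[unfolded \<omega>'] r eq]
  have "degree r = 0"
  proof (rule ccontr)
    assume "degree r \<noteq> 0"
    then obtain c where c: "poly r c = 0"
      using fundamental_theorem_of_algebra constant_degree by metis
    define T where "T = fls_const c + (fls_X :: complex fls)\<^sup>2"
    have T: "double_place T (\<lambda>p. int (order c p))"
      unfolding T_def by (rule double_place_finite)
    have "fls_deriv T = 2 * fls_X"
      by (simp add: T_def power2_eq_square)
    then have T': "fls_subdegree (fls_deriv T) = 1"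
      by simp
    have u: "t - fls_const c \<in> ?K"
      using generators_in_generated_field by (auto intro: K)
    have "transport t w T V (t - fls_const c) = fls_X\<^sup>2" if "model f T V" for V
      using that generators_in_generated_field
      by (simp add: transport_diff[OF m that] transport_t[OF m that] transport_const[OF m that] K)
        (simp add: T_def)
    then have u': "transport t w T V (t - fls_const c) \<noteq> 0 \<and>
        fls_subdegree (transport t w T V (t - fls_const c)) > 0" if "model f T V" for V
      using that by (simp add: power2_eq_square)
    have "order c r \<noteq> 0"
      using c r by (simp add: order_root)
    \<comment> \<open>The bounds read \<open>1 + 2 ord p0 \<ge> ord f + 2 ord r\<close> and
      \<open>1 + 2 ord p1 \<ge> 2 ord r\<close>; with \<open>ord r \<ge> 1\<close> both orders on
      the left must be positive.\<close>
    then have root: "poly p0 c = 0 \<and> poly p1 c = 0"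
      using bound[OF T u u'] T' order_root[of p0 c] order_root[of p1 c] by force
    obtain r' where r': "r = [:- c, 1:] * r'"
      using c by (metis dvdE poly_eq_0_iff_dvd)
    obtain q0 q1 where q: "p0 = [:- c, 1:] * q0" "p1 = [:- c, 1:] * q1"
      using root by (metis dvdE poly_eq_0_iff_dvd)
    define l where "l = ev [:- c, 1:] t"
    have "l \<noteq> 0"
      using m ev_eq_0_iff unfolding l_def model_def by (metis pCons_eq_0_iff zero_neq_one)
    moreover have "l * (\<phi> * w * ev r' t) = l * (ev q0 t + ev q1 t * w)"
      using eq unfolding r' q ev_simps(5) l_def[symmetric] by (simp add: algebra_simps)
    ultimately have "P r'"
      using r r' unfolding P_def by auto
    moreover have "degree r = Suc (degree r')"
      using r unfolding r' by (subst degree_mult_eq) auto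
    ultimately show False
      using min[of r'] by simp
  qed
  then obtain c where c: "r = [:c:]" "c \<noteq> 0"
    using r by (metis degree_eq_zeroE pCons_eq_0_iff)
  define T where "T = inverse ((fls_X :: complex fls)\<^sup>2)"
  have T: "double_place T (\<lambda>p. - int (degree p))"
    unfolding T_def by (rule double_place_infinite)
  have "fls_deriv T = - 2 * fls_X * inverse (fls_X ^ 4)"
    by (simp add: T_def fls_inverse_deriv power2_eq_square power4_eq_xxxx)
  then have T': "fls_subdegree (fls_deriv T) = - 3"
    by (simp add: fls_subdegree_pow)
  have t0: "t \<noteq> 0"
    using m ev_eq_0_iff[of t "[:0, 1:]"] by (auto simp: model_def)
  have u: "inverse t \<in> ?K"
    using generators_in_generated_field by (auto intro: K)
  have "transport t w T V (inverse t) = fls_X\<^sup>2" if "model f T V" for V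
    using that generators_in_generated_field
    by (simp add: transport_inverse[OF m that] transport_t[OF m that])
        (simp add: T_def)
  then have u': "transport t w T V (inverse t) \<noteq> 0 \<and>
      fls_subdegree (transport t w T V (inverse t)) > 0" if "model f T V" for V
    using that by (simp add: power2_eq_square)
  \<comment> \<open>Here \<open>r\<close> has degree 0, so the bounds read
    \<open>- 3 - 2 degree p0 \<ge> - (2 g + 1)\<close> and \<open>- 3 - 2 degree p1 \<ge> 0\<close>;
    the second is impossible.\<close>
  have p0: "p0 = 0 \<or> degree p0 < g" and "p1 = 0"
    using bound[OF T u u'] T' c deg by force+
  define p where "p = smult (inverse c) p0"
  have "\<phi> * w * fls_const c = ev p0 t"
    using eq c \<open>p1 = 0\<close> by simp
  then have "ev p t = \<phi> * w * (fls_const c * fls_const (inverse c))"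
    by (simp add: p_def mult_ac del: fls_const_mult_const)
  then have "\<phi> * w = ev p t"
    using c by simp
  then have "\<omega> = ev p t * fls_deriv t / w"
    using w by (simp add: \<omega>' field_simps)
  moreover have "p = 0 \<or> degree p < g"
    using p0 by (auto simp: p_def)
  ultimately show ?thesis by blast
qed

text \<open>This is the right-hand side of the equation in the chart \<open>x = 1/t\<close>. Zero is
  a simple root, as the reflected polynomial takes the value \<open>lead_coeff f\<close> there; a
  double root \<open>z\<close> elsewhere would give the double root \<open>1/z\<close> of
  \<open>f\<close>.\<close>

lemma rsquarefree_reflect: "rsquarefree (pCons 0 (reflect_poly f))"
  unfolding rsquarefree_roots
proof (intro allI notI)
  fix z assume a: "poly (pCons 0 (reflect_poly f)) z = 0 \<and>
    poly (pderiv (pCons 0 (reflect_poly f))) z = 0"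
  let ?r = "reflect_poly f"
  have z: "z \<noteq> 0"
    using a f_nonzero by (auto simp: pderiv_pCons)
  with a have r: "poly ?r z = 0" "poly (pderiv ?r) z = 0"
    by (auto simp: pderiv_pCons)
  define y where "y = inverse z"
  have y: "y \<noteq> 0" "inverse y = z"
    using z by (simp_all add: y_def)
  have f: "poly f x = x ^ degree f * poly ?r (inverse x)" if "x \<noteq> 0" for x
    using that poly_reflect_poly_nz[of "inverse x" f] by (simp add: field_simps)
  have "((\<lambda>x. x ^ degree f * poly ?r (inverse x)) has_field_derivative 0) (at y)"
    by (rule derivative_eq_intros poly_DERIV[THEN DERIV_chain2] refl | simp add: y r)+
  then have "(poly f has_field_derivative 0) (at y)"
    by (rule has_field_derivative_transform_within_open[of _ _ _ "- {0}"]) (use y f in auto)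
  then have "poly (pderiv f) y = 0"
    using poly_DERIV DERIV_unique by blast
  moreover have "poly f y = 0"
    using f[OF y(1)] y r by simp
  ultimately show False
    using sqfree unfolding rsquarefree_roots by blast
qed

end

section \<open>Regularity of differentials in an arbitrary valuation ring\<close>

lemma rsquarefree_bezout:
  fixes p :: "complex poly"
  assumes "rsquarefree p"
  obtains a b where "a * p + b * pderiv p = 1"
proof -
  have "degree (gcd p (pderiv p)) = 0"
  proof (rule ccontr)
    assume "degree (gcd p (pderiv p)) \<noteq> 0"
    then obtain z where "poly (gcd p (pderiv p)) z = 0"
      using fundamental_theorem_of_algebra constant_degree by metis
    then have "poly p z = 0 \<and> poly (pderiv p) z = 0"
      unfolding poly_eq_0_iff_dvd by (metis dvd_trans gcd_dvd1 gcd_dvd2)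
    with assms show False unfolding rsquarefree_roots by blast
  qed
  moreover have "p \<noteq> 0"
    using assms by (simp add: rsquarefree_def)
  ultimately have "coprime p (pderiv p)"
    by (metis coprime_iff_gcd_eq_1 gcd_eq_0_iff is_unit_gcd is_unit_iff_degree)
  then show thesis
    using bezout_coefficients_fst_snd[of p "pderiv p"] that by simp
qed

text \<open>The last claim is the case of integral closedness needed for \<open>w\<close>: if
  \<open>inverse x\<close> is in \<open>R\<close>, then so is
  \<open>x = x^2 * inverse x\<close>.\<close>

lemma valuation_ringD:
  assumes "R \<in> valuation_rings K"
  shows valuation_ring_const: "fls_const c \<in> R"
    and valuation_ring_mult: "x \<in> R \<Longrightarrow> y \<in> R \<Longrightarrow> x * y \<in> R"
    and valuation_ring_power: "x \<in> R \<Longrightarrow> x ^ n \<in> R"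
    and valuation_ring_ev: "x \<in> R \<Longrightarrow> ev p x \<in> R"
    and valuation_ring_cases: "x \<in> K \<Longrightarrow> x \<in> R \<or> inverse x \<in> R"
    and valuation_ring_sqrt: "x \<in> K \<Longrightarrow> x\<^sup>2 \<in> R \<Longrightarrow> x \<in> R"
proof -
  show c: "fls_const c \<in> R" for c
    using assms by (auto simp: valuation_rings_def)
  have d: "x - y \<in> R" if "x \<in> R" "y \<in> R" for x y
    using assms that by (simp add: valuation_rings_def)
  show m: "x * y \<in> R" if "x \<in> R" "y \<in> R" for x y
    using assms that by (simp add: valuation_rings_def)
  have a: "x + y \<in> R" if "x \<in> R" "y \<in> R" for x y
    using d[OF that(1) d[OF c[of 0] that(2)]] by simp
  show "x ^ n \<in> R" if "x \<in> R" for x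
    using that c[of 1] by (induction n) (simp_all add: m)
  show "ev p x \<in> R" if "x \<in> R" for p x
    using that c[of 0] by (induction p) (simp_all add: m a c)
  show v: "x \<in> R \<or> inverse x \<in> R" if "x \<in> K" for x
    using assms that by (simp add: valuation_rings_def)
  show "x \<in> R" if "x \<in> K" "x\<^sup>2 \<in> R" for x
  proof (cases "x = 0")
    case True
    then show ?thesis using c[of 0] by simp
  next
    case False
    then have "x\<^sup>2 * inverse x = x" by (simp add: power2_eq_square)
    then show ?thesis using v[OF that(1)] m[OF that(2)] by metis
  qed
qed

text \<open>If \<open>a F + b F' = 1\<close>, then \<open>du / w = a w du + 2 b dw\<close> on \<open>w\<^sup>2 = F(u)\<close>.\<close>

lemma regular_in_valuation_ring:
  assumes R: "R \<in> valuation_rings K" and u: "u \<in> R" and w: "w \<in> K" "w \<noteq> 0" "w\<^sup>2 = ev F u"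
    and F: "rsquarefree F" and c: "c \<in> R"
  shows "c * fls_deriv u / w \<in> differentials R"
proof -
  note RI = valuation_ring_const[OF R] valuation_ring_mult[OF R] valuation_ring_ev[OF R]
  have wR: "w \<in> R"
    using valuation_ring_sqrt[OF R] w u RI by simp
  obtain a b where ab: "a * F + b * pderiv F = 1"
    using rsquarefree_bezout[OF F] .
  have dw: "ev (pderiv F) u * fls_deriv u = 2 * w * fls_deriv w"
    using arg_cong[OF w(3), of fls_deriv] by (simp add: ev_deriv power2_eq_square mult.assoc)
  have "fls_deriv u = ev (a * F + b * pderiv F) u * fls_deriv u"
    by (simp add: ab)
  also have "\<dots> = ev a u * w\<^sup>2 * fls_deriv u + ev b u * (ev (pderiv F) u * fls_deriv u)"
    using w by (simp add: algebra_simps)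
  also have "\<dots> = w * (ev a u * w * fls_deriv u + 2 * ev b u * fls_deriv w)"
    unfolding dw by (simp add: algebra_simps power2_eq_square)
  finally have "fls_deriv u = w * (ev a u * w * fls_deriv u + 2 * ev b u * fls_deriv w)" .
  then have "fls_deriv u / w = ev a u * w * fls_deriv u + 2 * ev b u * fls_deriv w"
    using w(2) by (metis nonzero_mult_div_cancel_left)
  then have "c * fls_deriv u / w = c * (ev a u * w * fls_deriv u + 2 * ev b u * fls_deriv w)"
    by (metis times_divide_eq_right)
  also have "\<dots> = (\<Sum>i<2. (if i = 0 then c * ev a u * w else c * 2 * ev b u) *
      fls_deriv (if i = (0::nat) then u else w))"
    by (simp add: numeral_2_eq_2 algebra_simps)
  finally show ?thesis
    unfolding differentials_def mem_Collect_eq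
    using u wR c RI(1)[of 2] RI
    by (intro exI[of _ 2] exI[of _ "\<lambda>i. if i = 0 then c * ev a u * w else c * 2 * ev b u"]
        exI[of _ "\<lambda>i. if i = 0 then u else w"] conjI) auto
qed

context hyperelliptic
begin

text \<open>If \<open>t\<close> is in \<open>R\<close>, the equation \<open>w^2 = f(t)\<close>
  serves. Otherwise \<open>x = 1/t\<close> is in \<open>R\<close>, and with
  \<open>v = w * x^(g+1)\<close> the differential becomes \<open>- x^(g-1-i) dx / v\<close>, where
  \<open>i < g\<close> makes the power of \<open>x\<close> a polynomial.\<close>

lemma basis_regular:
  assumes m: "model f t w" and i: "i < g"
  shows "t ^ i * fls_deriv t / w \<in> regular_differentials (generated_field t w)"
proof -
  let ?K = "generated_field t w"
  note K = subfield_intros[OF subfield_generated_field]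
  note G = generators_in_generated_field
  have w: "w \<noteq> 0" and w2: "w\<^sup>2 = ev f t"
    using m f_nonzero ev_eq_0_iff by (auto simp: model_def)
  have t: "t \<noteq> 0"
    using m ev_eq_0_iff[of t "[:0, 1:]"] by (auto simp: model_def)
  have "t ^ i * fls_deriv t / w \<in> differentials R" if R: "R \<in> valuation_rings ?K" for R
  proof (cases "t \<in> R")
    case True
    then show ?thesis
      using R w w2 G by (intro regular_in_valuation_ring[OF R _ _ _ _ sqfree])
        (auto intro: valuation_ring_power)
  next
    case False
    define x where "x = inverse t"
    have x: "x \<in> R" "x \<noteq> 0" "x * t = 1" "inverse x = t"
      using False valuation_ring_cases[OF R G(1)] t by (auto simp: x_def)
    define v where "v = w * x ^ (g + 1)"
    have "v\<^sup>2 = ev f t * (x ^ (g + 1))\<^sup>2"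
      by (simp add: v_def power_mult_distrib w2)
    \<comment> \<open>Since \<open>2 (g + 1) = degree f + 1\<close>, one factor \<open>x\<close> is
      left over; it is the \<open>pCons 0\<close> in the equation for \<open>v\<close>.\<close>
    also have "(x ^ (g + 1))\<^sup>2 = x * x ^ degree f"
      by (simp add: deg power_even_eq power2_eq_square mult_2 power_add)
    also have "ev f t * (x * x ^ degree f) = ev (pCons 0 (reflect_poly f)) x"
      using x by (simp add: ev_reflect_poly)
    finally have v2: "v\<^sup>2 = ev (pCons 0 (reflect_poly f)) x" .
    have v: "v \<in> ?K" "v \<noteq> 0"
      using w x G unfolding v_def x_def by (auto intro!: K)
    have t': "fls_deriv t = - fls_deriv x * t\<^sup>2"
    proof -
      have "fls_deriv x = - (fls_deriv t * x\<^sup>2)"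
        by (simp add: x_def fls_inverse_deriv)
      moreover have "fls_deriv t = fls_deriv t * (x * t)\<^sup>2"
        by (simp add: x)
      ultimately show ?thesis
        by (simp add: power_mult_distrib)
    qed
    \<comment> \<open>The natural subtraction is exact because \<open>i < g\<close>. The facts up to
      \<open>p\<close> use \<open>x * t = 1\<close> to trade powers of \<open>x\<close> for powers
      of \<open>t\<close>.\<close>
    have "x ^ (g - 1 - i) * t ^ (g - 1 - i) = 1"
      using x by (simp flip: power_mult_distrib)
    moreover have "x ^ (g + 1) * t ^ (g + 1) = 1"
      using x by (metis power_mult_distrib power_one)
    moreover have "t ^ (g + 1) = t ^ (g - 1 - i) * (t ^ i * t\<^sup>2)"
    proof -
      have "g + 1 = (g - 1 - i) + (i + 2)" using i by simp
      then show ?thesis by (metis power_add)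
    qed
    moreover have "\<alpha> = \<xi> * \<mu>" if "\<alpha> * \<beta> = 1" "\<xi> * \<tau> = 1" "\<tau> = \<beta> * \<mu>" for \<alpha> \<beta> \<xi> \<tau> \<mu> :: "complex fls"
    proof -
      have "\<alpha> = \<alpha> * (\<xi> * (\<beta> * \<mu>))" using that by simp
      also have "\<dots> = \<alpha> * \<beta> * (\<xi> * \<mu>)" by (simp only: mult_ac)
      finally show ?thesis using that by simp
    qed
    ultimately have "x ^ (g - 1 - i) = x ^ (g + 1) * (t ^ i * t\<^sup>2)"
      by blast
    then have p: "x ^ (g - 1 - i) / x ^ (g + 1) = t ^ i * t\<^sup>2"
      using x(2) by simp
    have "t ^ i * fls_deriv t / w = (- 1 * x ^ (g - 1 - i)) * fls_deriv x / v"
      using w by (simp add: v_def t' p[symmetric] divide_simps mult.commute mult.left_commute)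
    moreover have "(- 1 * x ^ (g - 1 - i)) \<in> R"
      using valuation_ring_mult[OF R valuation_ring_const[OF R, of "- 1"]
          valuation_ring_power[OF R x(1)]] by simp
    ultimately show ?thesis
      by (simp only: regular_in_valuation_ring[OF R x(1) v v2 rsquarefree_reflect])
  qed
  moreover have "t ^ i * fls_deriv t / w \<in> differentials ?K"
    unfolding differentials_def mem_Collect_eq using G K
    by (intro exI[of _ 1] exI[of _ "\<lambda>_. t ^ i / w"] exI[of _ "\<lambda>_. t"]) auto
  ultimately show ?thesis
    by (simp add: regular_differentials_def)
qed

text \<open>The differentials \<open>t^i dt / w\<close> with \<open>i < g\<close> form a basis:
  \<open>regular_differential_form\<close> gives spanning, and transcendence of \<open>t\<close>
  gives independence.\<close>

theorem dim_regular_differentials: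
  assumes m: "model f t w"
  shows "fls_vs.dim (regular_differentials (generated_field t w)) = g"
proof -
  define b where "b i = t ^ i * fls_deriv t / w" for i
  have t: "t \<notin> range fls_const"
    using m by (simp add: model_def)
  have w: "w \<noteq> 0"
    using m f_nonzero ev_eq_0_iff by (auto simp: model_def)
  have t': "fls_deriv t \<noteq> 0"
    using t by (rule deriv_nonzero)
  have inj: "inj_on b {..<g}"
  proof (rule inj_onI)
    fix i j assume "b i = b j"
    then have "ev (monom 1 i - monom 1 j) t = 0"
      using w t' by (simp add: b_def ev_monom)
    then have "monom 1 i = (monom 1 j :: complex poly)"
      using t ev_eq_0_iff by (metis eq_iff_diff_eq_0)
    then show "i = j"
      by (metis monom_eq_iff' one_neq_zero)
  qed
  show ?thesis
  proof (rule fls_vs.dim_unique[of "b ` {..<g}"])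
    show "b ` {..<g} \<subseteq> regular_differentials (generated_field t w)"
      using basis_regular[OF m] by (auto simp: b_def)
    show "regular_differentials (generated_field t w) \<subseteq> fls_vs.span (b ` {..<g})"
    proof
      fix \<omega> assume "\<omega> \<in> regular_differentials (generated_field t w)"
      then obtain p where p: "p = 0 \<or> degree p < g" and \<omega>: "\<omega> = ev p t * fls_deriv t / w"
        using regular_differential_form[OF m] by blast
      have "p = (\<Sum>i<g. monom (coeff p i) i)"
        by (rule poly_eqI) (use p in \<open>auto simp: coeff_sum coeff_eq_0\<close>)
      then have "ev p t = (\<Sum>i<g. fls_const (coeff p i) * t ^ i)"
        by (metis (no_types, lifting) ev_monom ev_sum sum.cong)
      then have "\<omega> = (\<Sum>i<g. fls_const (coeff p i) * b i)"
        by (simp add: \<omega> b_def sum_distrib_right sum_divide_distrib mult.assoc)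
      also have "\<dots> \<in> fls_vs.span (b ` {..<g})"
        by (intro fls_vs.span_sum fls_vs.span_scale fls_vs.span_base) auto
      finally show "\<omega> \<in> fls_vs.span (b ` {..<g})" .
    qed
    show "\<not> fls_vs.dependent (b ` {..<g})"
    proof
      assume "fls_vs.dependent (b ` {..<g})"
      then obtain u i where i: "i < g" "u (b i) \<noteq> 0"
        and "(\<Sum>x\<in>b ` {..<g}. fls_const (u x) * x) = 0"
        by (subst (asm) fls_vs.dependent_finite) auto
      then have "(\<Sum>i<g. fls_const (u (b i)) * b i) = 0"
        using inj by (simp add: sum.reindex)
      moreover have "ev (\<Sum>i<g. monom (u (b i)) i) t * (fls_deriv t / w) =
          (\<Sum>i<g. fls_const (u (b i)) * b i)"
        unfolding ev_sum ev_monom sum_distrib_right by (rule sum.cong) (simp_all add: b_def)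
      ultimately have "ev (\<Sum>i<g. monom (u (b i)) i) t * (fls_deriv t / w) = 0"
        by simp
      then have "ev (\<Sum>i<g. monom (u (b i)) i) t = 0"
        using w t' by (simp del: ev_sum)
      then have "(\<Sum>i<g. monom (u (b i)) i) = 0"
        using t ev_eq_0_iff by blast
      then have "coeff (\<Sum>i<g. monom (u (b i)) i) i = 0"
        by simp
      then show False
        using i by (simp add: coeff_sum)
    qed
    show "card (b ` {..<g}) = g"
      using inj by (simp add: card_image)
  qed
qed

end

section \<open>Plane models\<close>

lemma subfield_range_const: "subfield (range fls_const)"
  unfolding subfield_def
proof (intro conjI ballI)
  fix x :: "complex fls" assume "x \<in> range fls_const"
  then obtain c where x: "x = fls_const c" by auto
  have "inverse x = fls_const (inverse c)"
  proof (cases "c = 0")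
    case False
    then have "x * fls_const (inverse c) = 1" by (simp add: x)
    then show ?thesis by (rule inverse_unique)
  qed (simp add: x)
  then show "inverse x \<in> range fls_const" by simp
qed (auto simp: fls_minus_const)

text \<open>Taking the constant coefficient is a ring homomorphism on power series, so a place sends
  a polynomial to its value at the centre.\<close>

lemma eval2_nth_0:
  assumes "fls_subdegree x \<ge> 0" "fls_subdegree y \<ge> 0"
  shows "fls_subdegree (eval2 p x y) \<ge> 0 \<and>
    fls_nth (eval2 p x y) 0 = poly (map_poly (\<lambda>c. poly c (fls_nth x 0)) p) (fls_nth y 0)"
proof (induction p)
  case (pCons c p)
  then show ?case
    using assms ev_nonneg[OF assms(1), of c] ev_nth_0[OF assms(1), of c]
    by (simp add: map_poly_pCons fls_nth_0_mult fls_nonneg_add fls_nonneg_mult)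
qed simp

context hyperelliptic
begin

lemma transport_eval2_field:
  assumes "model f t w" "model f T V" "a \<in> generated_field t w" "b \<in> generated_field t w"
  shows "transport t w T V (eval2 p a b) = eval2 p (transport t w T V a) (transport t w T V b)"
proof -
  let ?\<psi> = "transport t w T V"
  note m = assms(1,2)
  note K = subfield_intros[OF subfield_generated_field]
  have ev: "?\<psi> (ev q a) = ev q (?\<psi> a)" for q
    using assms transport_const[OF m, of 0]
    by (induction q) (simp_all add: transport_add[OF m] transport_mult[OF m] transport_const[OF m]
        ev_in_subfield[OF subfield_generated_field] K)
  show ?thesis
    using assms transport_const[OF m, of 0]
    by (induction p) (simp_all add: transport_add[OF m] transport_mult[OF m] ev
        eval2_in_subfield[OF subfield_generated_field] ev_in_subfield[OF subfield_generated_field] K)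
qed

text \<open>Over \<open>z = \<alpha>\<close> the curve has \<open>degree G\<close> distinct points, all of which are centres of
  places of the function field, so a factor vanishing at the generic point has full degree.\<close>

lemma irreducible_by_places:
  assumes m: "model f t w" and G: "lead_coeff G = 1" "degree G > 0"
    and ab: "a \<in> generated_field t w" "b \<in> generated_field t w" "eval2 G a b = 0"
    and S: "finite S" "card S \<ge> degree G"
    and pl: "\<And>\<beta>. \<beta> \<in> S \<Longrightarrow> \<exists>T V. model f T V \<and>
      fls_subdegree (transport t w T V a) \<ge> 0 \<and> fls_nth (transport t w T V a) 0 = \<alpha> \<and>
      fls_subdegree (transport t w T V b) \<ge> 0 \<and> fls_nth (transport t w T V b) 0 = \<beta>"
  shows "irreducible G"
proof -
  have unit: "k dvd 1" if hk: "G = h * k" and h: "eval2 h a b = 0" for h k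
  proof -
    have "h \<noteq> 0" "k \<noteq> 0" using hk G by auto
    have lc: "lead_coeff h * lead_coeff k = 1"
      using G hk by (simp add: lead_coeff_mult)
    then have "lead_coeff h dvd 1" by (metis dvd_triv_left)
    then obtain c where c: "lead_coeff h = [:c:]" "c \<noteq> 0"
      unfolding is_unit_poly_iff by (metis dvd_0_left one_neq_zero)
    \<comment> \<open>The restriction of \<open>h\<close> to the line \<open>z = \<alpha>\<close>.
      No degree is lost, because a factor of the monic \<open>G\<close> has a nonzero constant as
      leading coefficient.\<close>
    define h0 where "h0 = map_poly (\<lambda>c. poly c \<alpha>) h"
    have deg0: "degree h0 = degree h"
      unfolding h0_def by (rule map_poly_degree_eq) (simp add: c)
    then have "coeff h0 (degree h) = c"
      by (simp add: h0_def coeff_map_poly c)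
    then have "h0 \<noteq> 0"
      using c by auto
    have "S \<subseteq> {x. poly h0 x = 0}"
    proof
      fix \<beta> assume "\<beta> \<in> S"
      with pl obtain T V where mV: "model f T V"
        and a: "fls_subdegree (transport t w T V a) \<ge> 0" "fls_nth (transport t w T V a) 0 = \<alpha>"
        and b: "fls_subdegree (transport t w T V b) \<ge> 0" "fls_nth (transport t w T V b) 0 = \<beta>"
        by blast
      have "eval2 h (transport t w T V a) (transport t w T V b) = 0"
        using transport_eval2_field[OF m mV ab(1,2), of h] h transport_const[OF m mV, of 0] by simp
      then show "\<beta> \<in> {x. poly h0 x = 0}"
        using eval2_nth_0[OF a(1) b(1), of h] by (simp add: a b h0_def)
    qed
    then have "card S \<le> card {x. poly h0 x = 0}"
      by (rule card_mono[OF poly_roots_finite[OF \<open>h0 \<noteq> 0\<close>]])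
    also have "\<dots> \<le> degree h"
      using card_poly_roots_bound[OF \<open>h0 \<noteq> 0\<close>] deg0 by simp
    finally have "card S \<le> degree h" .
    moreover have "degree G = degree h + degree k"
      using \<open>h \<noteq> 0\<close> \<open>k \<noteq> 0\<close> by (simp add: hk degree_mult_eq)
    ultimately have "degree k = 0"
      using S by simp
    then obtain d where "k = [:d:]" by (metis degree_eq_zeroE)
    moreover from this have "d dvd 1"
      using lc by (auto intro: dvdI[of _ _ "lead_coeff h"] simp: mult.commute)
    ultimately show ?thesis
      by (simp add: is_unit_poly_iff)
  qed
  show ?thesis
  proof (rule irreducibleI)
    show "G \<noteq> 0" using G by auto
    show "\<not> G dvd 1" using G by (auto simp: is_unit_poly_iff)
    fix h k assume hk: "G = h * k"
    then have "eval2 h a b = 0 \<or> eval2 k a b = 0"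
      using ab by simp
    then show "h dvd 1 \<or> k dvd 1"
      using unit[OF hk] unit[of k h] hk by (auto simp: mult.commute)
  qed
qed

text \<open>The point \<open>(a, b)\<close> is generic, since two constants could not generate a
  field containing \<open>t\<close>; it generates the same field as \<open>(t, w)\<close>, whose
  regular differentials are already counted.\<close>

lemma genus_of_parametrization:
  assumes m: "model f t w" and "irreducible G" "eval2 G a b = 0"
    and "a \<in> generated_field t w" "b \<in> generated_field t w"
    and "t \<in> generated_field a b" "w \<in> generated_field a b"
  shows "has_geometric_genus G g"
proof -
  have "\<not> (a \<in> range fls_const \<and> b \<in> range fls_const)"
    using generated_field_least[OF subfield_range_const, of a b] assms m by (auto simp: model_def)
  then have "generic_point G a b"
    using assms by (simp add: generic_point_def)
  moreover have "generated_field a b = generated_field t w"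
    using assms by (intro generated_field_eqI)
  ultimately show ?thesis
    using dim_regular_differentials[OF m] assms(2)
    unfolding has_geometric_genus_def function_field_of_def by metis
qed

end

section \<open>Parametrized integral curves and their places over \<open>z = 0\<close>\<close>

lemma quotient_nth_0:
  fixes x v :: "complex fls"
  assumes "fls_subdegree x \<ge> 0" "fls_subdegree v = 0" "fls_nth v 0 \<noteq> 0"
  shows "fls_subdegree (x / v) \<ge> 0 \<and> fls_nth (x / v) 0 = fls_nth x 0 / fls_nth v 0"
proof -
  have v: "v \<noteq> 0" using assms by auto
  have i: "fls_subdegree (inverse v) \<ge> 0" using assms by simp
  have "fls_nth (inverse v) 0 * fls_nth v 0 = 1"
    using fls_nth_0_mult[OF i, of v] assms v by simp
  then have "fls_nth (inverse v) 0 = inverse (fls_nth v 0)"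
    by (metis inverse_unique mult.commute)
  then show ?thesis
    using fls_nonneg_mult[OF assms(1) i] fls_nth_0_mult[OF assms(1) i]
    by (simp add: divide_inverse)
qed

lemma eval2_deriv:
  "fls_deriv (eval2 p a b) =
    eval2 (map_poly pderiv p) a b * fls_deriv a + eval2 (pderiv p) a b * fls_deriv b"
  by (induction p) (simp_all add: map_poly_pCons pderiv_pCons ev_deriv algebra_simps)

text \<open>Along an integral curve through a nonsingular point of an invariant curve, \<open>G\<close> satisfies a
  linear homogeneous differential equation with regular coefficients and initial value zero.\<close>

lemma invariant_curve_vanishes:
  fixes a b :: "complex fls"
  assumes inv: "P * map_poly pderiv G + Q * pderiv G = K * G"
    and ode: "eval2 P a b * fls_deriv b = eval2 Q a b * fls_deriv a"
    and ab: "fls_subdegree a \<ge> 0" "fls_nth a 0 = 0" "fls_subdegree b \<ge> 0" "fls_nth b 0 = 0"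
    and P: "coeff (coeff P 0) 0 \<noteq> 0" and G: "coeff (coeff G 0) 0 = 0"
  shows "eval2 G a b = 0"
proof (rule ccontr)
  define E where "E = eval2 G a b"
  assume "eval2 G a b \<noteq> 0"
  then have E: "E \<noteq> 0" by (simp add: E_def)
  have n0: "fls_subdegree (eval2 p a b) \<ge> 0" "fls_nth (eval2 p a b) 0 = coeff (coeff p 0) 0" for p
    using eval2_nth_0[OF ab(1,3), of p] by (simp_all add: ab coeff_map_poly poly_0_coeff_0)
  have "fls_nth E 0 = 0" "fls_subdegree E \<ge> 0"
    unfolding E_def using n0[of G] G by simp_all
  then have sE: "fls_subdegree E > 0"
    using E nth_fls_subdegree_nonzero[OF E] by (metis le_less)
  then have dE: "fls_subdegree (fls_deriv E) = fls_subdegree E - 1"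
    by (intro fls_subdegree_deriv) simp
  then have E': "fls_deriv E \<noteq> 0"
    using E sE fls_deriv_eq_0_iff[of E] by (metis fls_const_subdegree less_irrefl)
  have p: "eval2 P a b \<noteq> 0" "fls_subdegree (eval2 P a b) = 0"
    using n0[of P] P fls_subdegree_leI[of "eval2 P a b" 0] by auto
  have "eval2 P a b * fls_deriv E = eval2 P a b * eval2 (map_poly pderiv G) a b * fls_deriv a +
      eval2 (pderiv G) a b * (eval2 P a b * fls_deriv b)"
    by (simp add: E_def eval2_deriv algebra_simps)
  also have "\<dots> = eval2 (P * map_poly pderiv G + Q * pderiv G) a b * fls_deriv a"
    unfolding ode by (simp add: algebra_simps)
  also have "\<dots> = (eval2 K a b * fls_deriv a) * E"
    unfolding inv by (simp add: E_def algebra_simps)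
  finally have e: "eval2 P a b * fls_deriv E = (eval2 K a b * fls_deriv a) * E" .
  define c where "c = eval2 K a b * fls_deriv a"
  have "c \<noteq> 0" using e E' p unfolding c_def by auto
  moreover have "fls_subdegree c \<ge> 0"
    unfolding c_def by (intro fls_nonneg_mult fls_nonneg_deriv n0 ab)
  \<comment> \<open>Compare orders in \<open>e\<close>: \<open>P\<close> is a unit and
    differentiation lowers the positive order of \<open>E\<close> by one, whereas the right side has
    at least the order of \<open>E\<close>.\<close>
  ultimately show False
    using arg_cong[OF e, of fls_subdegree] p E E' dE by (simp flip: c_def)
qed

text \<open>The shape shared by both curves: the hyperelliptic involution is \<open>(z, y) \<mapsto> (-z, -y)\<close>, and its
  fixed points are the origin (\<open>t = \<infinity>\<close>) and the five points at infinity (\<open>f t = 0\<close>).\<close>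

lemma genus_two_curve:
  fixes f A B :: "complex poly" and P Q K G :: "complex poly poly"
  assumes f: "rsquarefree f" "degree f = 5" and A: "degree A = 2" and B: "degree B = 7"
    and G: "lead_coeff G = 1" "degree G = 5"
    and \<mu>: "\<mu> \<noteq> 0" "\<nu> \<noteq> 0"
    and roots: "poly A t1 = 0" "poly A t2 = 0" "poly f t1 \<noteq> 0" "poly f t2 \<noteq> 0"
      "poly B t1 \<noteq> 0" "poly B t2 \<noteq> 0"
      "(poly B t1)\<^sup>2 * (poly f t2) ^ 3 \<noteq> (poly B t2)\<^sup>2 * (poly f t1) ^ 3"
    and inv: "P * map_poly pderiv G + Q * pderiv G = K * G"
      "coeff (coeff P 0) 0 \<noteq> 0" "coeff (coeff G 0) 0 = 0"
    and ode: "\<And>t w a b. model f t w \<Longrightarrow> w \<noteq> 0 \<Longrightarrow> a = fls_const \<mu> * (ev A t / w) \<Longrightarrow>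
      b = fls_const \<nu> * (ev B t / w ^ 3) \<Longrightarrow> eval2 P a b * fls_deriv b = eval2 Q a b * fls_deriv a"
    and t: "\<And>t w. model f t w \<Longrightarrow> t \<in> generated_field (ev A t / w) (ev B t / w ^ 3)"
  shows "has_geometric_genus G 2"
proof -
  interpret hyperelliptic f 2
    using f by unfold_locales simp_all
  define T\<^sub>0 where "T\<^sub>0 = inverse ((fls_X :: complex fls)\<^sup>2)"
  have pl0: "double_place T\<^sub>0 (\<lambda>p. - int (degree p))"
    unfolding T\<^sub>0_def by (rule double_place_infinite)
  obtain w where m: "model f T\<^sub>0 w"
    using model_exists[OF pl0 f_nonzero] .
  let ?K = "generated_field T\<^sub>0 w"
  note K = subfield_intros[OF subfield_generated_field]
  define a where "a T V = fls_const \<mu> * (ev A T / V)" for T V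
  define b where "b T V = fls_const \<nu> * (ev B T / V ^ 3)" for T V
  have w: "w \<noteq> 0"
    using m f_nonzero ev_eq_0_iff by (auto simp: model_def)
  have ev: "ev p T\<^sub>0 \<in> ?K" for p
    using eval2_in_generated_field[of "[:p:]" T\<^sub>0 w] by simp
  have ab: "a T\<^sub>0 w \<in> ?K" "b T\<^sub>0 w \<in> ?K"
    using ev generators_in_generated_field by (auto simp: a_def b_def intro!: K)
  have tab: "transport T\<^sub>0 w T V (a T\<^sub>0 w) = a T V" "transport T\<^sub>0 w T V (b T\<^sub>0 w) = b T V"
    if mV: "model f T V" for T V
    using transport_eq[OF m mV, of "[:0, 1:]" "[:smult \<mu> A:]"] w
      transport_eq[OF m mV, of "[:0, 1:] ^ 3" "[:smult \<nu> B:]"] by (simp_all add: a_def b_def)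
  have A0: "A \<noteq> 0" and B0: "B \<noteq> 0"
    using A B by auto
  have zero_place: "fls_subdegree (a T\<^sub>0 w) \<ge> 0 \<and> fls_nth (a T\<^sub>0 w) 0 = 0 \<and>
      fls_subdegree (b T\<^sub>0 w) \<ge> 0 \<and> fls_nth (b T\<^sub>0 w) 0 = 0"
  proof -
    have e: "ev p T\<^sub>0 \<noteq> 0 \<and> fls_subdegree (ev p T\<^sub>0) = - 2 * int (degree p)" if "p \<noteq> 0" for p
      using pl0 that by (auto simp: double_place_def)
    have "w * w = ev f T\<^sub>0"
      using m by (simp add: model_def power2_eq_square)
    then have "2 * fls_subdegree w = - 10"
      using fls_subdegree_mult[OF w w] e[OF f_nonzero] f by simp
    then have sw: "fls_subdegree w = - 5" by simp
    \<comment> \<open>The orders are \<open>- 4 + 5\<close> and \<open>- 14 + 15\<close>, from the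
      degrees 2 and 7 of \<open>A\<close> and \<open>B\<close> and the order \<open>- 5\<close> of
      \<open>w\<close>.\<close>
    have "fls_subdegree (a T\<^sub>0 w) = 1" "fls_subdegree (b T\<^sub>0 w) = 1"
      using e[OF A0] e[OF B0] w sw A B \<mu>
      by (simp_all add: a_def b_def divide_inverse fls_subdegree_pow)
    then show ?thesis by simp
  qed
  have vanish: "eval2 G (a T\<^sub>0 w) (b T\<^sub>0 w) = 0"
    using zero_place ode[OF m w a_def b_def] by (intro invariant_curve_vanishes[OF inv(1) _ _ _ _ _ inv(2,3)]) auto
  have other_place: "\<exists>T V. model f T V \<and> fls_subdegree (a T V) \<ge> 0 \<and> fls_nth (a T V) 0 = 0 \<and>
      fls_subdegree (b T V) \<ge> 0 \<and> fls_nth (b T V) 0 = \<nu> * (poly B c / s ^ 3)"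
    if c: "poly A c = 0" and s: "s\<^sup>2 = poly f c" "s \<noteq> 0" for c s
  proof -
    define T where "T = fls_const c + (fls_X :: complex fls)\<^sup>2"
    have pl: "double_place T (\<lambda>p. int (order c p))"
      unfolding T_def by (rule double_place_finite)
    obtain V' where mV': "model f T V'"
      using model_exists[OF pl f_nonzero] .
    have T: "fls_subdegree T \<ge> 0"
      unfolding T_def by (intro fls_nonneg_add fls_nonneg_power) simp_all
    have T0: "fls_nth T 0 = c"
      by (simp add: T_def power2_eq_square fls_nth_0_mult)
    have V'2: "V' * V' = ev f T"
      using mV' by (simp add: model_def power2_eq_square)
    moreover have "ev f T \<noteq> 0" "fls_subdegree (ev f T) = 0"
      using pl f_nonzero s order_root[of f c] by (auto simp: double_place_def)
    ultimately have V': "V' \<noteq> 0" "fls_subdegree V' = 0"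
      using fls_subdegree_mult[of V' V'] by fastforce+
    have "fls_nth V' 0 * fls_nth V' 0 = s * s"
      using fls_nth_0_mult[of V' V'] V' V'2 ev_nth_0[OF T, of f] T0 s by (simp add: power2_eq_square)
    \<comment> \<open>Both square roots of \<open>f(c)\<close> are reached by replacing
      \<open>V'\<close> with \<open>- V'\<close> if necessary, so each root of \<open>A\<close>
      yields two centres.\<close>
    then have "fls_nth V' 0 = s \<or> fls_nth V' 0 = - s"
      by (simp add: square_eq_iff)
    then obtain V where mV: "model f T V" and V: "fls_subdegree V = 0" "fls_nth V 0 = s"
      using mV' model_uminus[OF mV'] V' by (metis fls_uminus_nth fls_uminus_subdegree minus_minus)
    have V3: "fls_subdegree (V ^ 3) = 0" "fls_nth (V ^ 3) 0 = s ^ 3"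
      using V fls_nonneg_mult[of V V]
      by (simp add: fls_subdegree_pow, simp add: power3_eq_cube fls_nth_0_mult)
    have c0: "fls_subdegree (fls_const k) \<ge> 0" for k :: complex by simp
    have "fls_subdegree (ev A T / V) \<ge> 0" "fls_nth (ev A T / V) 0 = 0"
      "fls_subdegree (ev B T / V ^ 3) \<ge> 0" "fls_nth (ev B T / V ^ 3) 0 = poly B c / s ^ 3"
      using quotient_nth_0[OF ev_nonneg[OF T], of V A] quotient_nth_0[OF ev_nonneg[OF T], of "V ^ 3" B]
        V V3 s c by (simp_all add: ev_nth_0[OF T] T0)
    then have "fls_subdegree (a T V) \<ge> 0 \<and> fls_nth (a T V) 0 = 0 \<and>
        fls_subdegree (b T V) \<ge> 0 \<and> fls_nth (b T V) 0 = \<nu> * (poly B c / s ^ 3)"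
      unfolding a_def b_def
      by (simp add: fls_nth_0_mult[OF c0] fls_nonneg_mult[OF c0] del: times_divide_eq_right)
    then show ?thesis using mV by blast
  qed
  define s where "s c = csqrt (poly f c)" for c
  define \<beta> where "\<beta> c = \<nu> * (poly B c / s c ^ 3)" for c
  \<comment> \<open>The five centres over \<open>z = 0\<close>: the origin from
    \<open>t = \<infinity>\<close>, and a pair exchanged by the involution from each root of
    \<open>A\<close>.\<close>
  define S where "S = {0, \<beta> t1, - \<beta> t1, \<beta> t2, - \<beta> t2}"
  have s: "s c ^ 2 = poly f c" for c by (simp add: s_def)
  have s0: "s t1 \<noteq> 0" "s t2 \<noteq> 0" using roots by (auto simp: s_def)
  have \<beta>0: "\<beta> t1 \<noteq> 0" "\<beta> t2 \<noteq> 0"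
    using roots s0 \<mu> by (simp_all add: \<beta>_def)
  have \<beta>2: "(\<beta> t1)\<^sup>2 \<noteq> (\<beta> t2)\<^sup>2"
  proof
    have e: "(\<beta> c)\<^sup>2 = \<nu>\<^sup>2 * (poly B c)\<^sup>2 / poly f c ^ 3" for c
      by (simp add: \<beta>_def power_mult_distrib power_divide flip: s power_mult)
    assume "(\<beta> t1)\<^sup>2 = (\<beta> t2)\<^sup>2"
    then show False
      using roots \<mu> unfolding e by (simp add: frac_eq_eq)
  qed
  have "card S = 5"
  proof -
    have "x \<noteq> - x" if "x \<noteq> 0" for x :: complex
      using that by (simp add: eq_neg_iff_add_eq_0)
    moreover have "\<beta> t1 \<noteq> \<beta> t2" "\<beta> t1 \<noteq> - \<beta> t2"
      using \<beta>2 by (auto simp: power2_eq_iff)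
    moreover from this have "- \<beta> t1 \<noteq> \<beta> t2"
      by (metis minus_minus)
    ultimately show ?thesis
      using \<beta>0 unfolding S_def by (auto simp: card_insert_if)
  qed
  have "irreducible G"
  proof (rule irreducible_by_places[OF m G(1) _ ab, where S = S and \<alpha> = 0])
    show "eval2 G (a T\<^sub>0 w) (b T\<^sub>0 w) = 0"
      by (rule vanish)
    show "degree G > 0" "finite S" "card S \<ge> degree G"
      using G \<open>card S = 5\<close> by (simp_all add: S_def)
    fix x assume "x \<in> S"
    then consider "x = 0" | c r where "poly A c = 0" "r\<^sup>2 = poly f c" "r \<noteq> 0"
        "x = \<nu> * (poly B c / r ^ 3)"
      unfolding S_def \<beta>_def
      using roots s s0 power2_minus[of "s t1"] power2_minus[of "s t2"]
        that(2)[of t1 "s t1"] that(2)[of t1 "- s t1"] that(2)[of t2 "s t2"] that(2)[of t2 "- s t2"]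
      by auto
    then show "\<exists>T V. model f T V \<and>
      fls_subdegree (transport T\<^sub>0 w T V (a T\<^sub>0 w)) \<ge> 0 \<and> fls_nth (transport T\<^sub>0 w T V (a T\<^sub>0 w)) 0 = 0 \<and>
      fls_subdegree (transport T\<^sub>0 w T V (b T\<^sub>0 w)) \<ge> 0 \<and> fls_nth (transport T\<^sub>0 w T V (b T\<^sub>0 w)) 0 = x"
    proof cases
      case 1
      show ?thesis
        by (rule exI[of _ T\<^sub>0], rule exI[of _ w]) (use zero_place m tab[OF m] 1 in simp)
    next
      case (2 c r)
      then show ?thesis using other_place[OF 2(1-3)] tab by metis
    qed
  qed
  moreover have "T\<^sub>0 \<in> generated_field (a T\<^sub>0 w) (b T\<^sub>0 w)" "w \<in> generated_field (a T\<^sub>0 w) (b T\<^sub>0 w)"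
  proof -
    let ?L = "generated_field (a T\<^sub>0 w) (b T\<^sub>0 w)"
    note L = subfield_intros[OF subfield_generated_field[of "a T\<^sub>0 w" "b T\<^sub>0 w"]]
    have "inverse (fls_const \<mu>) * a T\<^sub>0 w \<in> ?L"
      by (rule L(7)[OF L(8)[OF L(1)] generators_in_generated_field(1)])
    moreover have "inverse (fls_const \<nu>) * b T\<^sub>0 w \<in> ?L"
      by (rule L(7)[OF L(8)[OF L(1)] generators_in_generated_field(2)])
    ultimately have xy: "ev A T\<^sub>0 / w \<in> ?L" "ev B T\<^sub>0 / w ^ 3 \<in> ?L"
      using \<mu> by (simp_all add: a_def b_def flip: mult.assoc)
    then show T: "T\<^sub>0 \<in> ?L"
      using t[OF m] generated_field_least[OF subfield_generated_field xy] by blast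
    have "ev A T\<^sub>0 \<noteq> 0"
      using A0 pl0 by (simp add: double_place_def)
    \<comment> \<open>Once \<open>t\<close> is in the field generated by the point, dividing
      \<open>A(t)\<close> by the first coordinate recovers \<open>w\<close>.\<close>
    then have "w = ev A T\<^sub>0 / (ev A T\<^sub>0 / w)"
      using w by simp
    then show "w \<in> ?L"
      using L(9)[OF ev_in_subfield[OF subfield_generated_field T] xy(1)] by metis
  qed
  ultimately show ?thesis
    using ab vanish by (intro genus_of_parametrization[OF m])
qed

section \<open>The parametrizations\<close>

text \<open>\<open>ident\<close> is the orbit equation of the system with denominators cleared. For
  \<open>x = A/w\<close> and \<open>y = B/w^3\<close> one has
  \<open>2 w^3 x' = (2 A' f - A f') t'\<close> and \<open>2 w^5 y' = (2 B' f - 3 B f') t'\<close>;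
  the scalings enter the unscaled equation only through \<open>k = \<mu> * \<nu>\<close>.\<close>

lemma parametrization_ode:
  fixes f A B :: "complex poly"
  assumes ident: "(smult k (A * B) + f\<^sup>2) * (2 * pderiv B * f - 3 * B * pderiv f) =
      smult k (3 * B\<^sup>2 + smult c\<^sub>2 (A * B * f) + smult c\<^sub>3 (A\<^sup>2 * f\<^sup>2) + smult c\<^sub>4 (f ^ 3)) *
        (2 * pderiv A * f - A * pderiv f)"
    and m: "model f t w" "w \<noteq> 0" and k: "\<mu> * \<nu> = k"
    and a: "a = fls_const \<mu> * (ev A t / w)" and b: "b = fls_const \<nu> * (ev B t / w ^ 3)"
  shows "(a * b + 1) * fls_deriv b =
    (3 * b\<^sup>2 + fls_const c\<^sub>2 * (b * fls_const \<nu>) * (ev A t / w) +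
      fls_const c\<^sub>3 * (fls_const \<nu> * (ev A t / w))\<^sup>2 + fls_const c\<^sub>4 * (fls_const \<nu>)\<^sup>2) * fls_deriv a"
proof -
  define x y where "x = ev A t / w" and "y = ev B t / w ^ 3"
  define \<phi> D where "\<phi> = ev f t" and "D = fls_deriv t"
  have w2: "w * w = \<phi>"
    using m by (simp add: model_def \<phi>_def power2_eq_square)
  have x: "x * w = ev A t" and y: "y * w ^ 3 = ev B t"
    using m by (simp_all add: x_def y_def)
  have w': "2 * w * fls_deriv w = ev (pderiv f) t * D"
    using arg_cong[OF w2, of fls_deriv] by (simp add: \<phi>_def D_def ev_deriv mult.assoc)
  have x': "fls_deriv x * (2 * w ^ 3) = ev (2 * pderiv A * f - A * pderiv f) t * D"
  proof -
    have e: "fls_deriv x * w + x * fls_deriv w = ev (pderiv A) t * D"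
      using arg_cong[OF x, of fls_deriv] by (simp add: D_def ev_deriv algebra_simps)
    have "fls_deriv x * (2 * w ^ 3) =
        2 * (w * w) * (fls_deriv x * w + x * fls_deriv w) - (x * w) * (2 * w * fls_deriv w)"
      by (simp add: algebra_simps power3_eq_cube)
    also have "\<dots> = ev (2 * pderiv A * f - A * pderiv f) t * D"
      unfolding e unfolding x w' w2 by (simp add: \<phi>_def algebra_simps)
    finally show ?thesis .
  qed
  have y': "fls_deriv y * (2 * w ^ 5) = ev (2 * pderiv B * f - 3 * B * pderiv f) t * D"
  proof -
    have e: "fls_deriv y * w ^ 3 + y * (3 * (w * w) * fls_deriv w) = ev (pderiv B) t * D"
      using arg_cong[OF y, of fls_deriv] by (simp add: D_def ev_deriv algebra_simps power3_eq_cube)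
    have "fls_deriv y * (2 * w ^ 5) =
        2 * (w * w) * (fls_deriv y * w ^ 3 + y * (3 * (w * w) * fls_deriv w)) -
        3 * (y * w ^ 3) * (2 * w * fls_deriv w)"
      by (simp add: algebra_simps eval_nat_numeral)
    also have "\<dots> = ev (2 * pderiv B * f - 3 * B * pderiv f) t * D"
      unfolding e unfolding y w' w2 by (simp add: \<phi>_def algebra_simps)
    finally show ?thesis .
  qed
  define K C2 C3 C4 where "K = fls_const k" and "C2 = fls_const c\<^sub>2" and "C3 = fls_const c\<^sub>3"
    and "C4 = fls_const c\<^sub>4"
  \<comment> \<open>The factor \<open>2 w^9\<close> turns each side into a polynomial in
    \<open>t\<close> times \<open>D\<close>, using \<open>w * w = \<phi>\<close>.\<close>
  have "(K * x * y + 1) * fls_deriv y * (2 * w ^ 9) =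
      (K * (x * w) * (y * w ^ 3) + (w * w)\<^sup>2) * (fls_deriv y * (2 * w ^ 5))"
    by (simp add: algebra_simps eval_nat_numeral)
  also have "\<dots> = ev ((smult k (A * B) + f\<^sup>2) * (2 * pderiv B * f - 3 * B * pderiv f)) t * D"
    unfolding y' unfolding x y w2 by (simp add: K_def \<phi>_def)
  also have "\<dots> = K * (3 * (y * w ^ 3)\<^sup>2 + C2 * ((x * w) * (y * w ^ 3) * (w * w)) +
      C3 * ((x * w)\<^sup>2 * (w * w)\<^sup>2) + C4 * (w * w) ^ 3) * (fls_deriv x * (2 * w ^ 3))"
    unfolding ident x' unfolding x y w2 by (simp add: K_def C2_def C3_def C4_def \<phi>_def)
  also have "\<dots> = K * (3 * y\<^sup>2 + C2 * (x * y) + C3 * x\<^sup>2 + C4) * fls_deriv x * (2 * w ^ 9)"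
    by (simp add: algebra_simps eval_nat_numeral)
  finally have e: "(K * x * y + 1) * fls_deriv y = K * (3 * y\<^sup>2 + C2 * (x * y) + C3 * x\<^sup>2 + C4) * fls_deriv x"
    using m by simp
  define M N where "M = fls_const \<mu>" and "N = fls_const \<nu>"
  have MN: "K = M * N"
    using k by (simp add: K_def M_def N_def)
  have d: "fls_deriv (M * x) = M * fls_deriv x" "fls_deriv (N * y) = N * fls_deriv y"
    by (simp_all add: M_def N_def)
  have "(M * x * (N * y) + 1) * (N * fls_deriv y) = N * ((K * x * y + 1) * fls_deriv y)"
    by (simp add: MN algebra_simps)
  also have "\<dots> = (3 * (N * y)\<^sup>2 + C2 * (N * y * N) * x + C3 * (N * x)\<^sup>2 + C4 * N\<^sup>2) * (M * fls_deriv x)"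
    unfolding e by (simp add: MN algebra_simps power2_eq_square)
  finally show ?thesis
    unfolding a b x_def[symmetric] y_def[symmetric] M_def[symmetric] N_def[symmetric] d
      C2_def[symmetric] C3_def[symmetric] C4_def[symmetric] .
qed

text \<open>Subscript 1 belongs to \<open>g1\<close> and 2 to \<open>g2\<close>. The five branches at infinity and the singular
  points of the curve determine the rational functions on the quotient with at most simple poles at
  infinity; \<open>t\<close> was found among their quotients by linear algebra.\<close>

definition f1 :: "complex poly" where "f1 = [:-2000, -2500, -1100, -200, -10, 1:]"
definition A1 :: "complex poly" where "A1 = [:-10, 0, 1:]"
definition B1 :: "complex poly" where
  "B1 = [:160000, 275000, 192000, 69500, 14200, 1890, 220, 17:]"

definition f2 :: "complex poly" where "f2 = [:10125, -16875, -3150, 1050, -15, 1:]"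
definition A2 :: "complex poly" where "A2 = [:15, 0, 1:]"
definition B2 :: "complex poly" where
  "B2 = [:-455625, 253125, -1036125, 203625, -27675, 1935, -255, 3:]"

lemma rsquarefreeI_bezout:
  fixes p :: "complex poly"
  assumes "a * p + b * pderiv p = [:c:]" "c \<noteq> 0"
  shows "rsquarefree p"
  unfolding rsquarefree_roots
proof (intro allI notI)
  fix z assume "poly p z = 0 \<and> poly (pderiv p) z = 0"
  then have "poly (a * p + b * pderiv p) z = 0" by simp
  with assms show False by simp
qed

text \<open>The witnesses are Bezout cofactors of \<open>f1\<close> and its derivative with
  denominators cleared, which leaves the constant \<open>-600000\<close> instead of 1.\<close>

lemma rsquarefree_f1: "rsquarefree f1"
  by (rule rsquarefreeI_bezout[of "[:-97200, -43050, -4740, 455:]" _ "[:78000, 63000, 15450, 1130, -91:]" "-600000"])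
    (simp_all add: f1_def pderiv_pCons)

lemma rsquarefree_f2: "rsquarefree f2"
  by (rule rsquarefreeI_bezout[of "[:-195975, 116775, -2145, 185:]" _ "[:435375, 103500, -38850, 540, -37:]" "-9331200000"])
    (simp_all add: f2_def pderiv_pCons)

text \<open>The parameter is scaled away: \<open>-6\<close> and \<open>-8\<close> are the
  coefficients of the system in units of \<open>q/17\<close>, \<open>5/2\<close> is
  \<open>\<mu> * \<nu>\<close>, and \<open>34/5\<close> is \<open>q / \<nu>^2\<close> for the
  scalings chosen in \<open>genus_g1\<close>.\<close>

lemma ode_identity1:
  "(smult (5 / 2) (A1 * B1) + f1\<^sup>2) * (2 * pderiv B1 * f1 - 3 * B1 * pderiv f1) =
      smult (5 / 2) (3 * B1\<^sup>2 + smult (-6) (A1 * B1 * f1) + smult (-8) (A1\<^sup>2 * f1\<^sup>2) + smult (34 / 5) (f1 ^ 3)) *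
        (2 * pderiv A1 * f1 - A1 * pderiv f1)"
  by (simp add: f1_def A1_def B1_def pderiv_pCons power2_eq_square power3_eq_cube numeral_poly)

text \<open>Here the unit is \<open>p/3\<close>, so \<open>16/3 * p^2\<close> appears as 48;
  \<open>15\<close> is \<open>\<mu> * \<nu>\<close> and \<open>1/5\<close> is
  \<open>p / \<nu>^2\<close> for the scalings in \<open>genus_g2\<close>.\<close>

lemma ode_identity2:
  "(smult 15 (A2 * B2) + f2\<^sup>2) * (2 * pderiv B2 * f2 - 3 * B2 * pderiv f2) =
      smult 15 (3 * B2\<^sup>2 + smult (-4) (A2 * B2 * f2) + smult (-48) (A2\<^sup>2 * f2\<^sup>2) + smult (1 / 5) (f2 ^ 3)) *
        (2 * pderiv A2 * f2 - A2 * pderiv f2)"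
  by (simp add: f2_def A2_def B2_def pderiv_pCons power2_eq_square power3_eq_cube numeral_poly)

section \<open>Invariance and degree\<close>

lemma complexify_simps [simp]:
  "complexify 0 = 0" "complexify 1 = 1"
  "complexify (p + q) = complexify p + complexify q"
  "complexify (p * q) = complexify p * complexify q"
  "complexify (Const c) = Const (complex_of_real c)" "complexify Z = Z" "complexify Y = Y"
  by (simp_all add: complexify_def map_poly_add_hom map_poly_mult_hom Const_def Z_def Y_def map_poly_pCons)

lemma complexify_diff [simp]: "complexify (p - q) = complexify p - complexify q"
  using complexify_simps(3)[of "p - q" q] by simp

lemma complexify_power [simp]: "complexify (p ^ n) = complexify p ^ n"
  by (induction n) simp_all

lemma coeff_complexify: "coeff (coeff (complexify p) j) i = complex_of_real (coeff (coeff p j) i)"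
  by (simp add: complexify_def coeff_map_poly)

lemma degree_complexify [simp]: "degree (complexify p) = degree p"
proof (cases "p = 0")
  case False
  then have "map_poly complex_of_real (lead_coeff p) \<noteq> 0"
    by (metis coeff_0 coeff_map_poly leading_coeff_0_iff of_real_0 of_real_eq_0_iff)
  then show ?thesis
    unfolding complexify_def by (rule map_poly_degree_eq)
qed simp

lemma map_poly_of_real_pderiv:
  "map_poly complex_of_real (pderiv p) = pderiv (map_poly complex_of_real p)"
  by (rule poly_eqI) (simp add: coeff_map_poly coeff_pderiv)

lemma complexify_deriv:
  "complexify (deriv_z p) = map_poly pderiv (complexify p)"
  "complexify (deriv_y p) = pderiv (complexify p)"
proof -
  show "complexify (deriv_z p) = map_poly pderiv (complexify p)"
    by (rule poly_eqI) (simp add: complexify_def deriv_z_def coeff_map_poly map_poly_of_real_pderiv)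
  have m: "map_poly complex_of_real (of_nat n * c) = of_nat n * map_poly complex_of_real c" for n c
    by (rule poly_eqI) (simp add: coeff_map_poly of_nat_poly)
  show "complexify (deriv_y p) = pderiv (complexify p)"
    by (rule poly_eqI, rule poly_eqI)
      (simp add: complexify_def deriv_y_def coeff_map_poly coeff_pderiv m del: of_nat_Suc)
qed

lemma invariant_curve_complexify:
  assumes "invariant_curve P Q g K"
  shows "complexify P * map_poly pderiv (complexify g) + complexify Q * pderiv (complexify g) =
    complexify K * complexify g"
  using arg_cong[OF assms[unfolded invariant_curve_def], of complexify]
  by (simp add: complexify_deriv)

lemma deriv_simps [simp]:
  "deriv_z (p + q) = deriv_z p + deriv_z q" "deriv_z (p * q) = deriv_z p * q + p * deriv_z q"
  "deriv_z (Const c) = 0" "deriv_z Z = 1" "deriv_z Y = 0"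
  "deriv_y (p + q) = deriv_y p + deriv_y q" "deriv_y (p * q) = deriv_y p * q + p * deriv_y q"
  "deriv_y (Const c) = 0" "deriv_y Z = 0" "deriv_y Y = 1"
proof -
  show a: "deriv_z (p + q) = deriv_z p + deriv_z q" for p q
    by (simp add: deriv_z_def map_poly_add_hom pderiv_add)
  show "deriv_z (p * q) = deriv_z p * q + p * deriv_z q"
  proof (induction p)
    case (pCons c p)
    have "deriv_z (smult c q) = smult (pderiv c) q + smult c (deriv_z q)"
      by (rule poly_eqI) (simp add: deriv_z_def coeff_map_poly pderiv_mult)
    moreover have "deriv_z (pCons d r) = pCons (pderiv d) (deriv_z r)" for d r
      by (simp add: deriv_z_def map_poly_pCons)
    ultimately show ?case
      using pCons by (simp add: a algebra_simps)
  qed (simp add: deriv_z_def)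
qed (simp_all add: deriv_z_def deriv_y_def Const_def Z_def Y_def map_poly_pCons pderiv_pCons
      pderiv_add pderiv_mult one_pCons)

lemma deriv_diff [simp]:
  "deriv_z (p - q) = deriv_z p - deriv_z q" "deriv_y (p - q) = deriv_y p - deriv_y q"
  using deriv_simps(1)[of "p - q" q] deriv_simps(6)[of "p - q" q] by simp_all

lemma deriv_power [simp]:
  "deriv_z (p ^ Suc n) = of_nat (Suc n) * p ^ n * deriv_z p"
  "deriv_y (p ^ Suc n) = of_nat (Suc n) * p ^ n * deriv_y p"
  by (induction n) (simp_all add: algebra_simps)

lemma deriv_power_numeral [simp]:
  "deriv_z (p ^ numeral k) = numeral k * p ^ (pred_numeral k) * deriv_z p"
  "deriv_y (p ^ numeral k) = numeral k * p ^ (pred_numeral k) * deriv_y p"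
  unfolding numeral_eq_Suc deriv_power by (simp_all add: numeral_eq_Suc[symmetric] del: of_nat_Suc)

text \<open>Reduces a polynomial identity to an identity of real numbers. Agreement in
  \<open>z\<close> gives equality at every constant \<open>[:y:]\<close>, and a nonzero
  \<open>p - q\<close> over \<open>real poly\<close> has only finitely many roots.\<close>

lemma poly_poly_eqI:
  fixes p q :: "real poly poly"
  assumes "\<And>z y. poly (poly p [:y:]) z = poly (poly q [:y:]) z"
  shows "p = q"
proof (rule ccontr)
  assume "p \<noteq> q"
  then have "finite {x. poly (p - q) x = 0}"
    by (intro poly_roots_finite) simp
  moreover have "range (\<lambda>y. [:y:]) \<subseteq> {x. poly (p - q) x = 0}"
  proof -
    have "poly p [:y:] = poly q [:y:]" for y
      using assms by (simp add: poly_eq_poly_eq_iff[symmetric] fun_eq_iff)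
    then show ?thesis by auto
  qed
  ultimately have "finite (range (\<lambda>y::real. [:y:]))"
    by (rule rev_finite_subset)
  moreover have "inj (\<lambda>y::real. [:y:])"
    by (simp add: inj_on_def)
  ultimately show False
    using finite_imageD infinite_UNIV_char_0 by blast
qed

lemma poly_poly_generators [simp]:
  "poly (poly (Const c) [:y:]) z = c" "poly (poly Z [:y:]) z = z" "poly (poly Y [:y:]) z = y"
  by (simp_all add: Const_def Z_def Y_def)

lemma invariant_g1:
  "invariant_curve (Z * Y + 1)
     (Const 3 * Y^2 - Const (6/17 * q) * Z * Y - Const (8/289 * q^2) * Z^2 + Const q)
     (g1 q) (Const 15 * Y)"
  unfolding invariant_curve_def
proof (rule poly_poly_eqI)
  fix z y
  \<comment> \<open>In terms of \<open>r\<close> the powers of 17 cancel from all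
    coefficients.\<close>
  define r where "r = q / 17"
  have q: "q = 17 * r" by (simp add: r_def)
  show "poly (poly ((Z * Y + 1) * deriv_z (g1 q) + (Const 3 * Y^2 - Const (6/17 * q) * Z * Y -
      Const (8/289 * q^2) * Z^2 + Const q) * deriv_y (g1 q)) [:y:]) z =
    poly (poly (Const 15 * Y * g1 q) [:y:]) z"
    unfolding g1_def q by (simp add: power_mult_distrib) algebra
qed

lemma invariant_g2:
  "invariant_curve (Z * Y + 1)
     (Const 3 * Y^2 - Const (4/3 * p) * Z * Y - Const (16/3 * p^2) * Z^2 + Const p)
     (g2 p) (Const 15 * Y)"
  unfolding invariant_curve_def
proof (rule poly_poly_eqI)
  fix z y
  \<comment> \<open>In terms of \<open>r\<close> the powers of 3 in the denominators shrink.\<close>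
  define r where "r = p / 3"
  have p: "p = 3 * r" by (simp add: r_def)
  show "poly (poly ((Z * Y + 1) * deriv_z (g2 p) + (Const 3 * Y^2 - Const (4/3 * p) * Z * Y -
      Const (16/3 * p^2) * Z^2 + Const p) * deriv_y (g2 p)) [:y:]) z =
    poly (poly (Const 15 * Y * g2 p) [:y:]) z"
    unfolding g2_def p by (simp add: power_mult_distrib) algebra
qed

section \<open>Degrees read off from monomials\<close>

lemma monomial_simps:
  "Const c = monom (monom c 0) 0" "Z = monom (monom 1 1) 0" "Y = monom (monom 1 0) 1"
  by (simp_all add: Const_def Z_def Y_def monom_0 monom_Suc one_pCons)

lemmas monomial_coeff = monomial_simps mult_monom monom_power coeff_monom

text \<open>A degree bound closed under sums and differences, so it can be checked monomial by
  monomial; one nonzero top coefficient then fixes \<open>total_degree\<close>.\<close>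

definition tdeg_le :: "nat \<Rightarrow> 'a::comm_ring_1 poly poly \<Rightarrow> bool" where
  "tdeg_le n p \<longleftrightarrow> (\<forall>i j. coeff (coeff p j) i \<noteq> 0 \<longrightarrow> i + j \<le> n)"

lemma tdeg_le_add: "tdeg_le n p \<Longrightarrow> tdeg_le n q \<Longrightarrow> tdeg_le n (p + q)"
  unfolding tdeg_le_def by (metis add.right_neutral coeff_add)

lemma tdeg_le_diff: "tdeg_le n p \<Longrightarrow> tdeg_le n q \<Longrightarrow> tdeg_le n (p - q)"
  unfolding tdeg_le_def by (metis cancel_comm_monoid_add_class.diff_zero coeff_diff diff_0_right)

lemma tdeg_le_monom:
  "i + j \<le> n \<Longrightarrow> tdeg_le n (monom (monom c i) j)" "j \<le> n \<Longrightarrow> tdeg_le n (monom 1 j)" "tdeg_le n 1"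
  by (auto simp: tdeg_le_def coeff_monom)

lemma total_degree_eqI:
  assumes "tdeg_le n p" "coeff (coeff p j) i \<noteq> 0" "i + j = n"
  shows "total_degree p = n"
  unfolding total_degree_def
proof (rule Max_eqI)
  let ?D = "{i + j | i j. coeff (coeff p j) i \<noteq> 0}"
  have "?D \<subseteq> {..n}"
    using assms(1) by (auto simp: tdeg_le_def)
  then show "finite (insert 0 ?D)" and "\<And>d. d \<in> insert 0 ?D \<Longrightarrow> d \<le> n"
    by (auto intro: finite_subset)
  show "n \<in> insert 0 ?D"
    using assms(2,3) by blast
qed

lemma quadratic_systemI:
  assumes "tdeg_le 2 Q" "coeff (coeff Q 2) 0 \<noteq> 0"
  shows "quadratic_system (Z * Y + 1) Q"
proof -
  have "total_degree (Z * Y + 1 :: real poly poly) = 2"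
    by (rule total_degree_eqI[of _ _ 1 1])
      (auto intro!: tdeg_le_add tdeg_le_monom simp: monomial_coeff)
  moreover have "total_degree Q = 2"
    using assms by (intro total_degree_eqI[of _ _ 2 0]) simp_all
  ultimately show ?thesis
    by (simp add: quadratic_system_def)
qed

lemma quadratic1:
  "quadratic_system (Z * Y + 1)
     (Const 3 * Y^2 - Const (6/17 * q) * Z * Y - Const (8/289 * q^2) * Z^2 + Const q)"
  by (rule quadratic_systemI)
    (auto intro!: tdeg_le_add tdeg_le_diff tdeg_le_monom simp: monomial_coeff)

lemma quadratic2:
  "quadratic_system (Z * Y + 1)
     (Const 3 * Y^2 - Const (4/3 * p) * Z * Y - Const (16/3 * p^2) * Z^2 + Const p)"
  by (rule quadratic_systemI)
    (auto intro!: tdeg_le_add tdeg_le_diff tdeg_le_monom simp: monomial_coeff)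

lemma total_degree_g1: "q \<noteq> 0 \<Longrightarrow> total_degree (g1 q) = 15"
  \<comment> \<open>The top monomial is \<open>z^15\<close>, whose coefficient is a nonzero multiple
    of \<open>q^10\<close>.\<close>
  by (rule total_degree_eqI[of _ _ 0 15])
    (auto intro!: tdeg_le_add tdeg_le_diff tdeg_le_monom simp: g1_def monomial_coeff)

lemma total_degree_g2: "p \<noteq> 0 \<Longrightarrow> total_degree (g2 p) = 15"
  by (rule total_degree_eqI[of _ _ 0 15])
    (auto intro!: tdeg_le_add tdeg_le_diff tdeg_le_monom simp: g2_def monomial_coeff)

lemma degree_g1: "degree (g1 q) = 5" "coeff (g1 q) 5 = 1" "coeff (coeff (g1 q) 0) 0 = 0"
proof -
  show c: "coeff (g1 q) 5 = 1" and "coeff (coeff (g1 q) 0) 0 = 0"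
    by (simp_all add: g1_def monomial_coeff)
  have "degree (g1 q) \<le> 5"
    by (rule degree_le) (simp add: g1_def monomial_coeff)
  then show "degree (g1 q) = 5"
    using le_degree[of "g1 q" 5] c by simp
qed

lemma degree_g2: "degree (g2 p) = 5" "coeff (g2 p) 5 = 1" "coeff (coeff (g2 p) 0) 0 = 0"
proof -
  show c: "coeff (g2 p) 5 = 1" and "coeff (coeff (g2 p) 0) 0 = 0"
    by (simp_all add: g2_def monomial_coeff)
  have "degree (g2 p) \<le> 5"
    by (rule degree_le) (simp add: g2_def monomial_coeff)
  then show "degree (g2 p) = 5"
    using le_degree[of "g2 p" 5] c by simp
qed

section \<open>The genus of the two curves\<close>

text \<open>Monomials of even degree in the two coordinates contain only even powers of
  \<open>w\<close>, so they are rational in \<open>t\<close> with powers of \<open>f\<close> as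
  denominators.\<close>

lemma model_products:
  assumes "model f t w" "w \<noteq> 0"
  shows "ev A t / w * (ev A t / w) * ev f t = (ev A t)\<^sup>2"
    "ev A t / w * (ev B t / w ^ 3) * (ev f t)\<^sup>2 = ev A t * ev B t"
    "ev B t / w ^ 3 * (ev B t / w ^ 3) * (ev f t) ^ 3 = (ev B t)\<^sup>2"
proof -
  have "ev f t = w * w"
    using assms by (simp add: model_def power2_eq_square)
  then show "ev A t / w * (ev A t / w) * ev f t = (ev A t)\<^sup>2"
    "ev A t / w * (ev B t / w ^ 3) * (ev f t)\<^sup>2 = ev A t * ev B t"
    "ev B t / w ^ 3 * (ev B t / w ^ 3) * (ev f t) ^ 3 = (ev B t)\<^sup>2"
    using assms by (simp_all add: field_simps eval_nat_numeral)
qed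

text \<open>\<open>P1\<close> and \<open>P2\<close> are even in the coordinates, and
  \<open>\<phi>^3\<close> clears their denominators to \<open>p1(t)\<close> and
  \<open>p2(t)\<close>. The identity \<open>p1 = t * p2\<close> then exhibits \<open>t\<close> as
  \<open>P1 / P2\<close>; \<open>p2\<close> is nonzero because its value at 1 is.\<close>

lemma parameter1:
  assumes m: "model f1 t w"
  shows "t \<in> generated_field (ev A1 t / w) (ev B1 t / w ^ 3)"
proof -
  define x y where "x = ev A1 t / w" and "y = ev B1 t / w ^ 3"
  let ?L = "generated_field x y"
  note L = subfield_intros[OF subfield_generated_field]
  have t: "t \<notin> range fls_const" and w2: "w\<^sup>2 = ev f1 t"
    using m by (auto simp: model_def)
  have \<phi>0: "ev f1 t \<noteq> 0"
    using ev_eq_0_iff[OF t, of f1] by (simp add: f1_def)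
  then have w: "w \<noteq> 0" using w2 by auto
  define s u v where "s = x * x" and "u = y * y" and "v = x * y"
  have sL: "s \<in> ?L" "u \<in> ?L" "v \<in> ?L"
    using generators_in_generated_field by (auto simp: s_def u_def v_def intro!: L)
  define \<phi> where "\<phi> = ev f1 t"
  have p: "s * \<phi> = (ev A1 t)\<^sup>2" "v * \<phi>\<^sup>2 = ev A1 t * ev B1 t" "u * \<phi> ^ 3 = (ev B1 t)\<^sup>2"
    using model_products[OF m w]
    by (simp_all add: s_def u_def v_def x_def y_def \<phi>_def)
  define P1 where "P1 = 81 - 930 * s + 3900 * s\<^sup>2 - 6000 * s ^ 3 + 5 * v - 1200 * (s * v) + 35 * u"
  define P2 where "P2 = 251 * s - 1155 * s\<^sup>2 + 2100 * s ^ 3 - 27 * v + 405 * (s * v) + u"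
  define p1 where "p1 = 81 * f1 ^ 3 - 930 * (A1\<^sup>2 * f1\<^sup>2) + 3900 * ((A1\<^sup>2)\<^sup>2 * f1) - 6000 * (A1\<^sup>2) ^ 3 +
    5 * (A1 * B1 * f1) - 1200 * (A1\<^sup>2 * (A1 * B1)) + 35 * B1\<^sup>2"
  define p2 where "p2 = 251 * (A1\<^sup>2 * f1\<^sup>2) - 1155 * ((A1\<^sup>2)\<^sup>2 * f1) + 2100 * (A1\<^sup>2) ^ 3 -
    27 * (A1 * B1 * f1) + 405 * (A1\<^sup>2 * (A1 * B1)) + B1\<^sup>2"
  have "P1 * \<phi> ^ 3 = 81 * \<phi> ^ 3 - 930 * ((s * \<phi>) * \<phi>\<^sup>2) + 3900 * ((s * \<phi>)\<^sup>2 * \<phi>) -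
      6000 * (s * \<phi>) ^ 3 + 5 * (v * \<phi>\<^sup>2 * \<phi>) - 1200 * ((s * \<phi>) * (v * \<phi>\<^sup>2)) + 35 * (u * \<phi> ^ 3)"
    by (simp add: P1_def algebra_simps power2_eq_square power3_eq_cube)
  then have P1: "P1 * \<phi> ^ 3 = ev p1 t"
    unfolding p by (simp add: p1_def \<phi>_def)
  have "P2 * \<phi> ^ 3 = 251 * ((s * \<phi>) * \<phi>\<^sup>2) - 1155 * ((s * \<phi>)\<^sup>2 * \<phi>) +
      2100 * (s * \<phi>) ^ 3 - 27 * (v * \<phi>\<^sup>2 * \<phi>) + 405 * ((s * \<phi>) * (v * \<phi>\<^sup>2)) + u * \<phi> ^ 3"
    by (simp add: P2_def algebra_simps power2_eq_square power3_eq_cube)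
  then have P2: "P2 * \<phi> ^ 3 = ev p2 t"
    unfolding p by (simp add: p2_def \<phi>_def)
  have "p1 = [:0, 1:] * p2"
    by (simp add: p1_def p2_def f1_def A1_def B1_def power2_eq_square power3_eq_cube numeral_poly)
  then have "P1 * \<phi> ^ 3 = t * P2 * \<phi> ^ 3"
    unfolding P1 mult.assoc P2 by simp
  then have "P1 = t * P2"
    using \<phi>0 by (simp add: \<phi>_def)
  moreover have "P2 \<noteq> 0"
  proof -
    have "poly p2 1 \<noteq> 0"
      by (simp add: p2_def f1_def A1_def B1_def)
    then have "p2 \<noteq> 0" by (metis poly_0)
    then have "ev p2 t \<noteq> 0"
      using ev_eq_0_iff[OF t] by blast
    then show ?thesis
      unfolding P2[symmetric] by (rule contrapos_nn) (simp only: mult_zero_left)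
  qed
  ultimately have "t = P1 / P2" by simp
  also have "\<dots> \<in> ?L"
    unfolding P1_def P2_def by (rule L sL)+
  finally show ?thesis
    by (simp add: x_def y_def)
qed

text \<open>As for the first curve, but the quotient involves the further monomials
  \<open>s^4\<close>, \<open>s^2 v\<close> and \<open>s u\<close>, so the fourth power of
  \<open>\<phi>\<close> is needed to clear denominators.\<close>

lemma parameter2:
  assumes m: "model f2 t w"
  shows "t \<in> generated_field (ev A2 t / w) (ev B2 t / w ^ 3)"
proof -
  define x y where "x = ev A2 t / w" and "y = ev B2 t / w ^ 3"
  let ?L = "generated_field x y"
  note L = subfield_intros[OF subfield_generated_field]
  have t: "t \<notin> range fls_const" and w2: "w\<^sup>2 = ev f2 t"
    using m by (auto simp: model_def)
  have \<phi>0: "ev f2 t \<noteq> 0"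
    using ev_eq_0_iff[OF t, of f2] by (simp add: f2_def)
  then have w: "w \<noteq> 0" using w2 by auto
  define s u v where "s = x * x" and "u = y * y" and "v = x * y"
  have sL: "s \<in> ?L" "u \<in> ?L" "v \<in> ?L"
    using generators_in_generated_field by (auto simp: s_def u_def v_def intro!: L)
  define \<phi> where "\<phi> = ev f2 t"
  have p: "s * \<phi> = (ev A2 t)\<^sup>2" "v * \<phi>\<^sup>2 = ev A2 t * ev B2 t" "u * \<phi> ^ 3 = (ev B2 t)\<^sup>2"
    using model_products[OF m w]
    by (simp_all add: s_def u_def v_def x_def y_def \<phi>_def)
  define P1 where "P1 = - 8 - 330 * s - 86400 * s\<^sup>2 + 6336000 * s ^ 3 - 829440000 * s ^ 4 - 315 * v +
    1200 * (s * v) - 7488000 * (s\<^sup>2 * v) - 45 * u - 14850 * (s * u)"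
  define P2 where "P2 = - 8 * s - 480 * s\<^sup>2 - 2688000 * s ^ 3 + 193536000 * s ^ 4 - 81 * v -
    7920 * (s * v) + 1804800 * (s\<^sup>2 * v) + 27 * u + 4410 * (s * u)"
  define p1 where "p1 = - 8 * f2 ^ 4 - 330 * (A2\<^sup>2 * f2 ^ 3) - 86400 * ((A2\<^sup>2)\<^sup>2 * f2\<^sup>2) +
    6336000 * ((A2\<^sup>2) ^ 3 * f2) - 829440000 * (A2\<^sup>2) ^ 4 - 315 * (A2 * B2 * f2\<^sup>2) +
    1200 * (A2\<^sup>2 * (A2 * B2) * f2) - 7488000 * ((A2\<^sup>2)\<^sup>2 * (A2 * B2)) - 45 * (B2\<^sup>2 * f2) -
    14850 * (A2\<^sup>2 * B2\<^sup>2)"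
  define p2 where "p2 = - 8 * (A2\<^sup>2 * f2 ^ 3) - 480 * ((A2\<^sup>2)\<^sup>2 * f2\<^sup>2) -
    2688000 * ((A2\<^sup>2) ^ 3 * f2) + 193536000 * (A2\<^sup>2) ^ 4 - 81 * (A2 * B2 * f2\<^sup>2) -
    7920 * (A2\<^sup>2 * (A2 * B2) * f2) + 1804800 * ((A2\<^sup>2)\<^sup>2 * (A2 * B2)) + 27 * (B2\<^sup>2 * f2) +
    4410 * (A2\<^sup>2 * B2\<^sup>2)"
  have "P1 * \<phi> ^ 4 = - 8 * \<phi> ^ 4 - 330 * ((s * \<phi>) * \<phi> ^ 3) - 86400 * ((s * \<phi>)\<^sup>2 * \<phi>\<^sup>2) +
      6336000 * ((s * \<phi>) ^ 3 * \<phi>) - 829440000 * (s * \<phi>) ^ 4 - 315 * (v * \<phi>\<^sup>2 * \<phi>\<^sup>2) +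
      1200 * ((s * \<phi>) * (v * \<phi>\<^sup>2) * \<phi>) - 7488000 * ((s * \<phi>)\<^sup>2 * (v * \<phi>\<^sup>2)) -
      45 * (u * \<phi> ^ 3 * \<phi>) - 14850 * ((s * \<phi>) * (u * \<phi> ^ 3))"
    by (simp add: P1_def algebra_simps eval_nat_numeral)
  then have P1: "P1 * \<phi> ^ 4 = ev p1 t"
    unfolding p by (simp add: p1_def \<phi>_def)
  have "P2 * \<phi> ^ 4 = - 8 * ((s * \<phi>) * \<phi> ^ 3) - 480 * ((s * \<phi>)\<^sup>2 * \<phi>\<^sup>2) -
      2688000 * ((s * \<phi>) ^ 3 * \<phi>) + 193536000 * (s * \<phi>) ^ 4 - 81 * (v * \<phi>\<^sup>2 * \<phi>\<^sup>2) -
      7920 * ((s * \<phi>) * (v * \<phi>\<^sup>2) * \<phi>) + 1804800 * ((s * \<phi>)\<^sup>2 * (v * \<phi>\<^sup>2)) +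
      27 * (u * \<phi> ^ 3 * \<phi>) + 4410 * ((s * \<phi>) * (u * \<phi> ^ 3))"
    by (simp add: P2_def algebra_simps eval_nat_numeral)
  then have P2: "P2 * \<phi> ^ 4 = ev p2 t"
    unfolding p by (simp add: p2_def \<phi>_def)
  have "p1 = [:0, 1:] * p2"
    by (simp add: p1_def p2_def f2_def A2_def B2_def power2_eq_square power3_eq_cube
        power4_eq_xxxx numeral_poly)
  then have "P1 * \<phi> ^ 4 = t * P2 * \<phi> ^ 4"
    unfolding P1 mult.assoc P2 by simp
  then have "P1 = t * P2"
    using \<phi>0 by (simp add: \<phi>_def)
  moreover have "P2 \<noteq> 0"
  proof -
    have "poly p2 1 \<noteq> 0"
      by (simp add: p2_def f2_def A2_def B2_def)
    then have "p2 \<noteq> 0" by (metis poly_0)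
    then have "ev p2 t \<noteq> 0"
      using ev_eq_0_iff[OF t] by blast
    then show ?thesis
      unfolding P2[symmetric] by (rule contrapos_nn) (simp only: mult_zero_left)
  qed
  ultimately have "t = P1 / P2" by simp
  also have "\<dots> \<in> ?L"
    unfolding P1_def P2_def by (rule L sL)+
  finally show ?thesis
    by (simp add: x_def y_def)
qed

text \<open>Both curves have \<open>n B\<^sup>2 \<equiv> (d + e t) f\<^sup>3\<close> modulo \<open>A\<close>, so the points over \<open>z = 0\<close> other than
  the origin satisfy \<open>n y\<^sup>2 = \<nu>\<^sup>2 (d + e t)\<close> with \<open>A t = 0\<close>.\<close>

lemma genus_two_curve_from_identities:
  fixes f A B F1 F2 H1 H2 H3 :: "complex poly" and g Q K :: "real poly poly"
  assumes f: "rsquarefree f" "degree f = 5" and A: "A = [:- r, 0, 1:]" "r \<noteq> 0" and B: "degree B = 7"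
    and fA: "f * F1 + A * F2 = [:n1:]" "n1 \<noteq> 0"
    and BA: "B * H1 + A * H2 = [:n2:]" "n2 \<noteq> 0"
    and BfA: "smult n (B\<^sup>2) = [:d, e:] * f ^ 3 + A * H3" "n \<noteq> 0" "e \<noteq> 0"
    and g: "degree g = 5" "coeff g 5 = 1" "coeff (coeff g 0) 0 = 0"
    and inv: "invariant_curve (Z * Y + 1) Q g K"
    and \<mu>: "\<mu> \<noteq> 0" "\<nu> \<noteq> 0"
    and ode: "\<And>t w a b. model f t w \<Longrightarrow> w \<noteq> 0 \<Longrightarrow> a = fls_const \<mu> * (ev A t / w) \<Longrightarrow>
      b = fls_const \<nu> * (ev B t / w ^ 3) \<Longrightarrow>
      (a * b + 1) * fls_deriv b = eval2 (complexify Q) a b * fls_deriv a"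
    and t: "\<And>t w. model f t w \<Longrightarrow> t \<in> generated_field (ev A t / w) (ev B t / w ^ 3)"
  shows "has_geometric_genus (complexify g) 2"
proof -
  define t1 where "t1 = csqrt r"
  have t1: "t1\<^sup>2 = r" "t1 \<noteq> 0"
    using A by (simp_all add: t1_def)
  have A0: "poly A t1 = 0" "poly A (- t1) = 0"
    using t1 by (simp_all add: A(1) power2_eq_square)
  \<comment> \<open>At a root of \<open>A\<close> the identities \<open>fA\<close> and
    \<open>BA\<close> become products equal to the nonzero constants \<open>n1\<close> and
    \<open>n2\<close>.\<close>
  have nz: "poly f c \<noteq> 0 \<and> poly B c \<noteq> 0" if "poly A c = 0" for c
    using arg_cong[OF fA(1), of "\<lambda>p. poly p c"] arg_cong[OF BA(1), of "\<lambda>p. poly p c"] fA(2) BA(2) that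
    by auto
  have e: "n * (poly B c)\<^sup>2 = (d + e * c) * (poly f c) ^ 3" if "poly A c = 0" for c
    using arg_cong[OF BfA(1), of "\<lambda>p. poly p c"] that by (simp add: algebra_simps)
  have "t1 \<noteq> - t1"
    using t1 by (simp add: eq_neg_iff_add_eq_0)
  \<comment> \<open>By \<open>e\<close> the sides share the factor \<open>f(t1)^3 f(-t1)^3\<close>
    and differ in \<open>d + e * t1\<close> against \<open>d - e * t1\<close>.\<close>
  then have "n * (poly B t1)\<^sup>2 * (poly f (- t1)) ^ 3 \<noteq> n * (poly B (- t1))\<^sup>2 * (poly f t1) ^ 3"
    unfolding e[OF A0(1)] e[OF A0(2)] using nz[OF A0(1)] nz[OF A0(2)] BfA(3) by simp
  then have "(poly B t1)\<^sup>2 * (poly f (- t1)) ^ 3 \<noteq> (poly B (- t1))\<^sup>2 * (poly f t1) ^ 3"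
    by auto
  moreover have "lead_coeff (complexify g) = 1"
    by (rule poly_eqI) (simp add: coeff_complexify g coeff_1)
  moreover have "coeff (coeff (Z * Y + 1 :: complex poly poly) 0) 0 \<noteq> 0"
    by (simp add: Z_def Y_def)
  ultimately show ?thesis
    using genus_two_curve[OF f _ B _ _ \<mu> A0 _ _ _ _ _ invariant_curve_complexify[OF inv] _ _ _ t] nz[OF A0(1)] nz[OF A0(2)] g ode
    by (simp add: A(1) coeff_complexify)
qed

lemma genus_g1:
  assumes "q \<noteq> 0"
  shows "has_geometric_genus (complexify (g1 q)) 2"
proof -
  \<comment> \<open>Taking \<nu> as \<open>q/17\<close> times \<mu> matches the units of
    \<open>ode_identity1\<close>; then \<open>34/5 * \<nu>^2 = q\<close> forces this square. The
    complex root also covers negative \<open>q\<close>.\<close>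
  define \<mu> where "\<mu> = csqrt (85 / (2 * complex_of_real q))"
  define \<nu> where "\<nu> = complex_of_real q / 17 * \<mu>"
  have \<mu>2: "\<mu> * \<mu> = 85 / (2 * complex_of_real q)"
    by (simp add: \<mu>_def flip: power2_eq_square)
  then have \<mu>: "\<mu> \<noteq> 0" "\<nu> \<noteq> 0"
    using assms by (auto simp: \<nu>_def)
  have k: "\<mu> * \<nu> = 5 / 2"
    using \<mu>2 assms by (simp add: \<nu>_def field_simps)
  have \<nu>2: "34 / 5 * \<nu>\<^sup>2 = complex_of_real q"
    using \<mu>2 assms by (simp add: \<nu>_def power2_eq_square field_simps)
  let ?Q = "Const 3 * Y^2 - Const (6/17 * q) * Z * Y - Const (8/289 * q^2) * Z^2 + Const q"
  have ode: "(a * b + 1) * fls_deriv b = eval2 (complexify ?Q) a b * fls_deriv a"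
    if m: "model f1 t w" "w \<noteq> 0" and a: "a = fls_const \<mu> * (ev A1 t / w)"
      and b: "b = fls_const \<nu> * (ev B1 t / w ^ 3)" for t w a b
  proof -
    define c where "c = fls_const (complex_of_real q / 17)"
    have \<nu>x: "fls_const \<nu> * (ev A1 t / w) = c * a"
      by (simp add: \<nu>_def a c_def flip: fls_const_mult_const)
    have "fls_const (34 / 5) * (fls_const \<nu>)\<^sup>2 = fls_const (34 / 5 * \<nu>\<^sup>2)"
      by (simp flip: fls_const_power)
    then have n: "fls_const (34 / 5) * (fls_const \<nu>)\<^sup>2 = fls_const (complex_of_real q)"
      by (simp only: \<nu>2)
    have c: "fls_const (6 * complex_of_real q / 17) = 6 * c"
      "fls_const (8 * (complex_of_real q)\<^sup>2 / 289) = 8 * c\<^sup>2"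
      by (simp_all add: c_def power2_eq_square flip: fls_const_numeral)
    have "3 * b\<^sup>2 + fls_const (-6) * (b * fls_const \<nu>) * (ev A1 t / w) +
        fls_const (-8) * (fls_const \<nu> * (ev A1 t / w))\<^sup>2 + fls_const (34 / 5) * (fls_const \<nu>)\<^sup>2 =
        3 * b\<^sup>2 - 6 * c * a * b - 8 * c\<^sup>2 * a\<^sup>2 + fls_const (complex_of_real q)"
      unfolding mult.assoc[of b] mult.assoc[of _ "b * _"] \<nu>x n
      by (simp add: \<nu>x mult.assoc power_mult_distrib mult.left_commute mult.commute
          del: fls_const_mult_const)
    then show ?thesis
      using parametrization_ode[OF ode_identity1 m k a b] by (simp add: c)
  qed
  show ?thesis
    \<comment> \<open>\<open>F1\<close>, \<open>F2\<close> are Bezout cofactors for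
      \<open>f1\<close> and \<open>A1\<close>, and \<open>H1\<close>, \<open>H2\<close> for
      \<open>B1\<close> and \<open>A1\<close>, with denominators cleared; \<open>H3\<close> is the
      quotient of \<open>15 B1^2 + (35 + t) f1^3\<close> by \<open>A1\<close>.\<close>
    by (rule genus_two_curve_from_identities[where f = f1 and A = A1 and B = B1 and r = 10 and \<mu> = \<mu> and \<nu> = \<nu>
          and d = "-35" and e = "-1" and n = 15
          and ?F1.0 = "[:-35, 11:]" and ?F2.0 = "[:6400, 6550, 1740, 145, -11:]" and ?n1.0 = 6000
          and ?H1.0 = "[:155, -49:]" and ?n2.0 = 360000
          and ?H2.0 = "[:2444000, 3478500, 1872900, 484300, 66840, 8145, 833:]"
          and ?H3.0 = "[:-10400000000, -26200000000, -26187500000, -10722500000, 2051750000, 4809550000, 2752800000, 898680000, 186315000, 24892000, 2107850, 109450, 2995, 5, 1:]",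
          OF rsquarefree_f1 _ _ _ _ _ _ _ _ _ _ _ degree_g1 invariant_g1 \<mu> ode parameter1])
      (simp_all add: f1_def A1_def B1_def power2_eq_square power3_eq_cube)
qed

lemma genus_g2:
  assumes "p \<noteq> 0"
  shows "has_geometric_genus (complexify (g2 p)) 2"
proof -
  \<comment> \<open>With \<nu> equal to \<open>p/3\<close> times \<mu>, the condition
    \<open>1/5 * \<nu>^2 = p\<close> forces this square.\<close>
  define \<mu> where "\<mu> = csqrt (45 / complex_of_real p)"
  define \<nu> where "\<nu> = complex_of_real p / 3 * \<mu>"
  have \<mu>2: "\<mu> * \<mu> = 45 / complex_of_real p"
    by (simp add: \<mu>_def flip: power2_eq_square)
  then have \<mu>: "\<mu> \<noteq> 0" "\<nu> \<noteq> 0"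
    using assms by (auto simp: \<nu>_def)
  have k: "\<mu> * \<nu> = 15"
    using \<mu>2 assms by (simp add: \<nu>_def field_simps)
  have \<nu>2: "1 / 5 * \<nu>\<^sup>2 = complex_of_real p"
    using \<mu>2 assms by (simp add: \<nu>_def power2_eq_square field_simps)
  let ?Q = "Const 3 * Y^2 - Const (4/3 * p) * Z * Y - Const (16/3 * p^2) * Z^2 + Const p"
  have ode: "(a * b + 1) * fls_deriv b = eval2 (complexify ?Q) a b * fls_deriv a"
    if m: "model f2 t w" "w \<noteq> 0" and a: "a = fls_const \<mu> * (ev A2 t / w)"
      and b: "b = fls_const \<nu> * (ev B2 t / w ^ 3)" for t w a b
  proof -
    define c where "c = fls_const (complex_of_real p / 3)"
    have \<nu>x: "fls_const \<nu> * (ev A2 t / w) = c * a"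
      by (simp add: \<nu>_def a c_def flip: fls_const_mult_const)
    have "fls_const (1 / 5) * (fls_const \<nu>)\<^sup>2 = fls_const (1 / 5 * \<nu>\<^sup>2)"
      by (simp flip: fls_const_power)
    then have n: "fls_const (1 / 5) * (fls_const \<nu>)\<^sup>2 = fls_const (complex_of_real p)"
      by (simp only: \<nu>2)
    have c: "fls_const (4 * complex_of_real p / 3) = 4 * c"
      "fls_const (16 * (complex_of_real p)\<^sup>2 / 3) = 48 * c\<^sup>2"
      by (simp_all add: c_def power2_eq_square flip: fls_const_numeral)
    have "3 * b\<^sup>2 + fls_const (-4) * (b * fls_const \<nu>) * (ev A2 t / w) +
        fls_const (-48) * (fls_const \<nu> * (ev A2 t / w))\<^sup>2 + fls_const (1 / 5) * (fls_const \<nu>)\<^sup>2 =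
        3 * b\<^sup>2 - 4 * c * a * b - 48 * c\<^sup>2 * a\<^sup>2 + fls_const (complex_of_real p)"
      unfolding mult.assoc[of b] mult.assoc[of _ "b * _"] \<nu>x n
      by (simp add: \<nu>x mult.assoc power_mult_distrib mult.left_commute mult.commute
          del: fls_const_mult_const)
    then show ?thesis
      using parametrization_ode[OF ode_identity2 m k a b] by (simp add: c)
  qed
  show ?thesis
    \<comment> \<open>The same kinds of certificates: Bezout cofactors modulo \<open>A2\<close> for
      \<open>f2\<close> and for \<open>B2\<close>, and \<open>H3\<close> as the quotient of
      \<open>180 B2^2 + (5 - 3 t) f2^3\<close> by \<open>A2\<close>.\<close>
    by (rule genus_two_curve_from_identities[where f = f2 and A = A2 and B = B2 and r = "-15" and \<mu> = \<mu> and \<nu> = \<nu>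
          and d = "-5" and e = 3 and n = 180
          and ?F1.0 = "[:5, 3:]" and ?F2.0 = "[:111825, 3600, -3030, 40, -3:]" and ?n1.0 = 1728000
          and ?H1.0 = "[:45, 11:]" and ?n2.0 = 829440000
          and ?H2.0 = "[:56662875, -425250, -854775, 177300, -9315, 2670, -33:]"
          and ?H3.0 = "[:2837119921875, -4705467187500, 15508051171875, -10161348750000, 12482199984375, -3811458037500, 434976834375, -5958360000, -1025004375, 22873500, 660825, 63600, -10035, 140, -3:]",
          OF rsquarefree_f2 _ _ _ _ _ _ _ _ _ _ _ degree_g2 invariant_g2 \<mu> ode parameter2])
      (simp_all add: f2_def A2_def B2_def power2_eq_square power3_eq_cube)
qed

theorem corollary4:
  fixes q p :: real
  shows
    "(q \<noteq> 0 \<longrightarrow>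
        (let P = Z * Y + 1;
             Q = Const 3 * Y^2 - Const (6/17 * q) * Z * Y - Const (8/289 * q^2) * Z^2 + Const q
         in quadratic_system P Q \<and>
            invariant_curve P Q (g1 q) (Const 15 * Y) \<and>
            total_degree (g1 q) = 15 \<and>
            has_geometric_genus (complexify (g1 q)) 2)) \<and>
     (p \<noteq> 0 \<longrightarrow>
        (let P = Z * Y + 1;
             Q = Const 3 * Y^2 - Const (4/3 * p) * Z * Y - Const (16/3 * p^2) * Z^2 + Const p
         in quadratic_system P Q \<and>
            invariant_curve P Q (g2 p) (Const 15 * Y) \<and>
            total_degree (g2 p) = 15 \<and>
            has_geometric_genus (complexify (g2 p)) 2))"
  unfolding Let_def
  by (intro conjI impI quadratic1 quadratic2 invariant_g1 invariant_g2 total_degree_g1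
      total_degree_g2 genus_g1 genus_g2)

end
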